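(* Let $A_n=\frac{1}{\sqrt n}(a_{jk})_{j,k=1}^n$ be a matrix from the Gaussian Unitary Ensemble, i.e. a Hermitian $n\times n$ matrix with $\{\Re a_{jk}=\Re a_{kj}\}_{j<k}$ and $\{\Im a_{jk}=-\Im a_{kj}\}_{j<k}$ i.i.d. $N(0,1/2)$ random variables and $\{a_{ii}\}_{1\le i\le n}$ i.i.d. $N(0,1)$ random variables, all independent. For $z\in\mathbb{C}$ with $\Im z\neq 0$ set $G_n(z)=(A_n-2-z n^{-2/3})^{-1}$ (where $A_n-w$ means $A_n-w\,\mathrm{Id}$), $g_{n,k}(z)=n^{-2k/3}\,\mathrm{Tr}\,G_n^k(z)$ for integers $k\ge 2$, and $g^c_{n,1}(z)=n^{-2/3}\left(n+\mathrm{Tr}\,G_n(z)\right)$. For a multi-index $K=(k_1,\dots,k_j)$, $j\ge1$, of nonnegative integers, let $$m_K=\mathbb{E}\Big((g^c_{n,1}(z))^{k_1}\prod_{l=2}^j (g_{n,l}(z))^{k_l}\Big),$$ and let $e_l$ denote the multi-index whose $l$-th component is $1$ and all other components are $0$. Then for every non-zero multi-index $K$, $$m_K\,(z+O(n^{-2/3}))-m_{K+2e_1}(1+O(n^{-2/3}))-\sum_{l\ge1} l\,k_l\, m_{K-e_l+e_{l+2}}(1+O(n^{-2/3}))=O(n^{-1/3})\,m_{K+e_1},$$ where the term $k_l\, m_{K-e_l+e_{l+2}}$ is interpreted as $0$ when $k_l=0$. Moreover, the following boundary condition holds: $$z+O(n^{-2/3})-m_{2e_1}(1+O(n^{-2/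3}))=O(n^{-1/3})\,m_{e_1}.$$
   Context: Multi-indices are added componentwise, extending by zero components as needed (a component beyond the length of a multi-index is $0$, i.e. the corresponding factor is absent from $m_K$). The symbols $O(n^{-a})$ denote (possibly different) quantities, as $n\to\infty$, bounded in absolute value by a constant times $n^{-a}$. *)

theory Defs
  imports "HOL-Probability.Probability" "HOL-Library.Landau_Symbols"
    "Jordan_Normal_Form.Gauss_Jordan_Elimination"
begin

text \<open>Underlying real Gaussian parameters of a GUE matrix of size n.
  The sample space consists of functions x on the index set {..<n} x {..<n}:
  for j < k, x(j,k) is Re a_jk and x(k,j) is Im a_jk (both N(0,1/2));
  x(j,j) is a_jj (N(0,1)); all coordinates independent (product measure).\<close>

definition gue_param_measure :: "nat \<Rightarrow> ((nat \<times> nat) \<Rightarrow> real) measure" where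
  "gue_param_measure n =
     PiM ({..<n} \<times> {..<n})
       (\<lambda>(j,k). if j = k then density lborel (normal_density 0 1)
                else density lborel (normal_density 0 (sqrt (1/2))))"

definition gue_entry :: "((nat \<times> nat) \<Rightarrow> real) \<Rightarrow> nat \<Rightarrow> nat \<Rightarrow> complex" where
  "gue_entry x j k =
     (if j = k then complex_of_real (x (j,j))
      else if j < k then Complex (x (j,k)) (x (k,j))
      else Complex (x (k,j)) (- x (j,k)))"

definition gue_matrix :: "nat \<Rightarrow> ((nat \<times> nat) \<Rightarrow> real) \<Rightarrow> complex mat" where
  "gue_matrix n x = mat n n (\<lambda>(j,k). gue_entry x j k / complex_of_real (sqrt (real n)))"

definition mtrace :: "complex mat \<Rightarrow> complex" where
  "mtrace M = (\<Sum>i<dim_row M. M $$ (i,i))"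

definition resolvent :: "nat \<Rightarrow> complex \<Rightarrow> ((nat \<times> nat) \<Rightarrow> real) \<Rightarrow> complex mat" where
  "resolvent n z x =
     the (mat_inverse (gue_matrix n x
        - (2 + z * complex_of_real (real n powr (-2/3))) \<cdot>\<^sub>m 1\<^sub>m n))"

definition g_nk :: "nat \<Rightarrow> nat \<Rightarrow> complex \<Rightarrow> ((nat \<times> nat) \<Rightarrow> real) \<Rightarrow> complex" where
  "g_nk n k z x = complex_of_real (real n powr (- 2 * real k / 3)) * mtrace (resolvent n z x ^\<^sub>m k)"

definition gc_n1 :: "nat \<Rightarrow> complex \<Rightarrow> ((nat \<times> nat) \<Rightarrow> real) \<Rightarrow> complex" where
  "gc_n1 n z x = complex_of_real (real n powr (-2/3)) * (of_nat n + mtrace (resolvent n z x))"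

text \<open>Multi-indices are functions K :: nat \<Rightarrow> nat with finite support,
  components indexed from 1 (component 0 is unused and required to be 0).
  Components outside the support are 0, so the corresponding factors are 1.\<close>
definition multi_index :: "(nat \<Rightarrow> nat) \<Rightarrow> bool" where
  "multi_index K \<longleftrightarrow> K 0 = 0 \<and> finite {l. K l \<noteq> 0}"

definition unit_mi :: "nat \<Rightarrow> nat \<Rightarrow> nat" where
  "unit_mi l = (\<lambda>i. if i = l then 1 else 0)"

definition moment :: "nat \<Rightarrow> complex \<Rightarrow> (nat \<Rightarrow> nat) \<Rightarrow> complex" where
  "moment n z K =
     (\<integral>x. gc_n1 n z x ^ K 1 * (\<Prod>l\<in>{l. 2 \<le> l \<and> K l \<noteq> 0}. g_nk n l z x ^ K l)
        \<partial>gue_param_measure n)"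

end

theory Submission
  imports Defs "Jordan_Normal_Form.Determinant"
begin

text \<open>The recursion is exact for every \<open>n > 0\<close>, without the error terms multiplying \<open>m\<^sub>K\<close>,
  \<open>m\<^bsub>K+2e\<^esub>\<close> and the summands. Write \<open>w = 2 + z n\<^bsup>-2/3\<^esup>\<close>, \<open>T = Tr G\<close>, and let \<open>F\<close> be the
  product of powers defining \<open>m\<^sub>K\<close>. Since \<open>n + w T = Tr (A G)\<close> is linear in the Gaussian coordinates
  apart from the factor \<open>G\<close>, integrating by parts in every coordinate gives the Schwinger-Dyson equation
  \<open>E[(n + w T) F] = - E[T\<^sup>2 F] / n - (1/n) * (sum over l of l k\<^sub>l n\<^bsup>-2l/3\<^esup> E[Tr G\<^bsup>l+2\<^esup> F / g\<^sub>l])\<close>.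
  Substituting \<open>T = n\<^bsup>2/3\<^esup> g\<^sub>1 - n\<close>, the terms of order \<open>n\<close> and \<open>n\<^bsup>2/3\<^esup>\<close> cancel because of the shift by 2
  (the spectral edge), and dividing by \<open>n\<^bsup>1/3\<^esup>\<close> leaves the claim with the single error
  \<open>z n\<^bsup>-1/3\<^esup> m\<^bsub>K+e\<^esub>\<close>, where \<open>e\<close> is the first unit multi-index. The boundary condition is the
  case \<open>K = 0\<close>.\<close>

subsection \<open>Gaussian integration by parts\<close>

text \<open>Stein's identity. With \<open>\<phi>\<close> the density, \<open>\<phi> * f\<close> has
  derivative \<open>\<phi> * f' - (t / s^2) * \<phi> * f\<close>. Its integral over the line
  vanishes, because \<open>f\<close> is bounded and \<open>\<phi>\<close> tends to 0 at both
  ends.\<close>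

lemma gaussian_ibp_line:
  fixes f f' :: "real \<Rightarrow> complex"
  assumes s: "0 < s"
    and deriv: "\<And>t. (f has_vector_derivative f' t) (at t)"
    and cont: "continuous_on UNIV f'"
    and bnd: "\<And>t. norm (f t) \<le> B" and bnd': "\<And>t. norm (f' t) \<le> B'"
  shows "(LINT t|density lborel (normal_density 0 s). complex_of_real t * f t)
       = complex_of_real (s\<^sup>2) * (LINT t|density lborel (normal_density 0 s). f' t)"
proof -
  define \<phi> where "\<phi> = normal_density 0 s"
  have \<phi>_nonneg: "0 \<le> \<phi> t" for t by (simp add: \<phi>_def)
  have contf: "continuous_on UNIV f"
    by (meson continuous_at_imp_continuous_on deriv has_vector_derivative_continuous)
  have \<phi>_meas[measurable]: "\<phi> \<in> borel_measurable borel" by (simp add: \<phi>_def)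
  have [measurable]: "f \<in> borel_measurable borel" "f' \<in> borel_measurable borel"
    using contf cont by (auto intro: borel_measurable_continuous_onI)
  have \<phi>_deriv: "(\<phi> has_vector_derivative (- (t / s\<^sup>2) * \<phi> t)) (at t)" for t
    unfolding has_real_derivative_iff_has_vector_derivative[symmetric] \<phi>_def normal_density_def
    by (rule derivative_eq_intros refl | use s in \<open>simp add: field_simps power2_eq_square\<close>)+
  have \<phi>_cont: "continuous_on UNIV \<phi>"
    by (meson continuous_at_imp_continuous_on \<phi>_deriv has_vector_derivative_continuous)
  have int1: "integrable lborel (\<lambda>t. \<phi> t *\<^sub>R f' t)"
  proof (rule Bochner_Integration.integrable_bound)
    show "integrable lborel (\<lambda>t. B' * \<phi> t)" using s by (simp add: \<phi>_def)
    show "AE t in lborel. norm (\<phi> t *\<^sub>R f' t) \<le> norm (B' * \<phi> t)"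
      using bnd' \<phi>_nonneg
      by (auto simp: abs_mult intro!: AE_I2) (metis abs_of_nonneg mult.commute mult_left_mono order_trans abs_ge_self)
  qed simp
  have int2: "integrable lborel (\<lambda>t. \<phi> t *\<^sub>R (complex_of_real t * f t))"
  proof (rule Bochner_Integration.integrable_bound)
    show "integrable lborel (\<lambda>t. B * (\<phi> t * t))"
      using integrable_normal_moment_nz_1[OF s, of 0] by (simp add: \<phi>_def)
    show "AE t in lborel. norm (\<phi> t *\<^sub>R (complex_of_real t * f t)) \<le> norm (B * (\<phi> t * t))"
    proof (intro AE_I2)
      fix t
      have "norm (\<phi> t *\<^sub>R (complex_of_real t * f t)) = \<bar>\<phi> t * t\<bar> * norm (f t)"
        by (simp add: norm_mult abs_mult)
      also have "\<dots> \<le> \<bar>\<phi> t * t\<bar> * \<bar>B\<bar>"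
        by (intro mult_left_mono order_trans[OF bnd]) auto
      finally show "norm (\<phi> t *\<^sub>R (complex_of_real t * f t)) \<le> norm (B * (\<phi> t * t))"
        by (simp add: abs_mult mult.commute)
    qed
  qed simp
  define F' where "F' = (\<lambda>t. \<phi> t *\<^sub>R f' t - (1 / s\<^sup>2) *\<^sub>R (\<phi> t *\<^sub>R (complex_of_real t * f t)))"
  have intF': "integrable lborel F'" unfolding F'_def
    by (intro Bochner_Integration.integrable_diff integrable_scaleR_right int1 int2)
  have F_deriv: "((\<lambda>t. \<phi> t *\<^sub>R f t) has_vector_derivative F' t) (at t)" for t
  proof -
    have "((\<lambda>t. \<phi> t *\<^sub>R f t) has_vector_derivative (\<phi> t *\<^sub>R f' t + (- (t / s\<^sup>2) * \<phi> t) *\<^sub>R f t)) (at t)"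
      using \<phi>_deriv deriv
      by (intro has_vector_derivative_scaleR) (auto simp: has_real_derivative_iff_has_vector_derivative)
    also have "\<phi> t *\<^sub>R f' t + (- (t / s\<^sup>2) * \<phi> t) *\<^sub>R f t = F' t"
      by (simp add: F'_def scaleR_conv_of_real field_simps)
    finally show ?thesis .
  qed
  \<comment> \<open>Keeping the filter arbitrary lets one argument serve both boundary terms;
    \<open>\<phi>\<close> depends on \<open>t\<close> only through \<open>t^2\<close>.\<close>
  have lim: "((\<lambda>t. \<phi> t *\<^sub>R f t) \<longlongrightarrow> 0) F" if F: "(\<phi> \<longlongrightarrow> 0) F" for F
  proof (rule Lim_null_comparison)
    show "\<forall>\<^sub>F t in F. norm (\<phi> t *\<^sub>R f t) \<le> B * \<phi> t"
      using bnd \<phi>_nonneg by (intro always_eventually) (auto simp: mult.commute[of B] intro!: mult_left_mono)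
    show "((\<lambda>t. B * \<phi> t) \<longlongrightarrow> 0) F" using tendsto_mult_right_zero[OF F] by simp
  qed
  have sq: "filterlim (\<lambda>t::real. t\<^sup>2 / (2 * s\<^sup>2)) at_top at_top" "filterlim (\<lambda>t::real. t\<^sup>2 / (2 * s\<^sup>2)) at_top at_bot"
  proof -
    have c: "0 < 1 / (2 * s\<^sup>2)" using s by simp
    have "filterlim (\<lambda>t::real. t\<^sup>2) at_top at_top"
      by (rule filterlim_pow_at_top) (auto intro: filterlim_ident)
    moreover have "filterlim (\<lambda>t::real. t\<^sup>2) at_top at_bot"
      by (rule filterlim_pow_at_bot_even) (auto intro: filterlim_ident)
    ultimately show "filterlim (\<lambda>t::real. t\<^sup>2 / (2 * s\<^sup>2)) at_top at_top" "filterlim (\<lambda>t::real. t\<^sup>2 / (2 * s\<^sup>2)) at_top at_bot"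
      using filterlim_tendsto_pos_mult_at_top[OF tendsto_const c] by auto
  qed
  have \<phi>_lim: "(\<phi> \<longlongrightarrow> 0) F" if F: "filterlim (\<lambda>t::real. t\<^sup>2 / (2 * s\<^sup>2)) at_top F" for F
  proof -
    have "((\<lambda>t. exp (- (t\<^sup>2 / (2 * s\<^sup>2)))) \<longlongrightarrow> 0) F"
      using F by (intro filterlim_compose[OF exp_at_bot]) (simp add: filterlim_uminus_at_top)
    from tendsto_mult_right_zero[OF this, of "1 / sqrt (2 * pi * s\<^sup>2)"]
    show ?thesis unfolding \<phi>_def normal_density_def by simp
  qed
  have "(LBINT t=-\<infinity>..\<infinity>. F' t) = 0 - 0"
  proof (rule interval_integral_FTC_integrable[where F = "\<lambda>t. \<phi> t *\<^sub>R f t"])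
    show "isCont F' t" for t
      unfolding F'_def using \<phi>_cont contf cont
      by (intro continuous_intros) (auto simp: continuous_on_eq_continuous_at)
    show "set_integrable lborel (einterval (- \<infinity>) \<infinity>) F'"
      using intF' by (simp add: set_integrable_def einterval_def)
    show "(((\<lambda>t. \<phi> t *\<^sub>R f t) \<circ> real_of_ereal) \<longlongrightarrow> 0) (at_right (- \<infinity>))"
      "(((\<lambda>t. \<phi> t *\<^sub>R f t) \<circ> real_of_ereal) \<longlongrightarrow> 0) (at_left \<infinity>)"
      using lim[OF \<phi>_lim[OF sq(1)]] lim[OF \<phi>_lim[OF sq(2)]]
      by (simp_all add: ereal_tendsto_simps)
  qed (use F_deriv in auto)
  hence "(LBINT t. F' t) = 0"
    by (simp add: interval_integral_to_infinity_eq interval_lebesgue_integral_def einterval_def set_lebesgue_integral_def)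
  moreover have "(LBINT t. F' t) = (LBINT t. \<phi> t *\<^sub>R f' t)
      - (1 / s\<^sup>2) *\<^sub>R (LBINT t. \<phi> t *\<^sub>R (complex_of_real t * f t))"
    unfolding F'_def Bochner_Integration.integral_diff[OF int1 integrable_scaleR_right[OF int2]]
    by (simp only: integral_scaleR_right)
  ultimately have "(LBINT t. \<phi> t *\<^sub>R f' t) = (1 / s\<^sup>2) *\<^sub>R (LBINT t. \<phi> t *\<^sub>R (complex_of_real t * f t))"
    by simp
  hence "complex_of_real (s\<^sup>2) * (LBINT t. \<phi> t *\<^sub>R f' t) = (LBINT t. \<phi> t *\<^sub>R (complex_of_real t * f t))"
    using s by (simp add: scaleR_conv_of_real)
  thus ?thesis
    by (simp add: integral_density \<phi>_def)
qed

section \<open>The Gaussian product space and integration by parts in one coordinate\<close>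

definition gue_sd :: "nat \<times> nat \<Rightarrow> real" where
  "gue_sd p = (if fst p = snd p then 1 else sqrt (1/2))"

lemma gue_sd_pos: "0 < gue_sd p"
  by (simp add: gue_sd_def)

lemma gue_param_measure_eq:
  "gue_param_measure n = PiM ({..<n} \<times> {..<n}) (\<lambda>p. density lborel (normal_density 0 (gue_sd p)))"
  unfolding gue_param_measure_def gue_sd_def by (intro arg_cong2[where f = PiM] ext) auto

lemma prob_space_gue: "prob_space (gue_param_measure n)"
  unfolding gue_param_measure_eq by (intro prob_space_PiM prob_space_normal_density gue_sd_pos)

text \<open>The last condition constrains \<open>f\<close> along each coordinate line only; no joint continuity is needed
  for integrating by parts in one coordinate.\<close>

definition tame :: "nat \<Rightarrow> (((nat \<times> nat) \<Rightarrow> real) \<Rightarrow> complex) \<Rightarrow> bool" where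
  "tame n f \<longleftrightarrow> f \<in> borel_measurable (gue_param_measure n) \<and> (\<exists>B. \<forall>x. norm (f x) \<le> B)
     \<and> (\<forall>x p. continuous_on UNIV (\<lambda>t. f (x(p := t))))"

lemma tame_const: "tame n (\<lambda>_. c)"
  unfolding tame_def by auto

lemma tame_add:
  assumes "tame n f" "tame n g"
  shows "tame n (\<lambda>x. f x + g x)"
proof -
  obtain A B where "\<forall>x. norm (f x) \<le> A" "\<forall>x. norm (g x) \<le> B" using assms unfolding tame_def by blast
  hence "\<forall>x. norm (f x + g x) \<le> A + B" by (auto intro: norm_triangle_mono)
  thus ?thesis using assms unfolding tame_def by (auto intro!: continuous_intros)
qed

lemma tame_mult:
  assumes "tame n f" "tame n g"
  shows "tame n (\<lambda>x. f x * g x)"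
proof -
  obtain A B where AB: "\<forall>x. norm (f x) \<le> A" "\<forall>x. norm (g x) \<le> B" using assms unfolding tame_def by blast
  hence "0 \<le> A" by (meson norm_ge_zero order_trans)
  hence "\<forall>x. norm (f x * g x) \<le> A * B" using AB by (auto simp: norm_mult intro!: mult_mono)
  thus ?thesis using assms unfolding tame_def by (auto intro!: continuous_intros)
qed

lemma tame_sum: "(\<And>i. i \<in> I \<Longrightarrow> tame n (f i)) \<Longrightarrow> tame n (\<lambda>x. \<Sum>i\<in>I. f i x)"
  by (induction I rule: infinite_finite_induct) (auto intro: tame_add tame_const)

lemma tame_prod: "(\<And>i. i \<in> I \<Longrightarrow> tame n (f i)) \<Longrightarrow> tame n (\<lambda>x. \<Prod>i\<in>I. f i x)"
  by (induction I rule: infinite_finite_induct) (auto intro: tame_mult tame_const)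

lemma tame_power: "tame n f \<Longrightarrow> tame n (\<lambda>x. f x ^ k)"
  by (induction k) (auto intro: tame_mult tame_const)

lemmas tame_intros = tame_const tame_add tame_mult tame_sum tame_prod tame_power

lemma tame_integrable:
  assumes "tame n f"
  shows "integrable (gue_param_measure n) f"
proof -
  interpret prob_space "gue_param_measure n" by (rule prob_space_gue)
  obtain B where "\<And>x. norm (f x) \<le> B" using assms unfolding tame_def by blast
  thus ?thesis using assms by (intro integrable_const_bound[of f B]) (auto simp: tame_def)
qed

text \<open>Coordinates are unbounded and so not \<open>tame\<close>. Integrability comes from the
  marginal law, a normal distribution with finite first moment; measurability of the coordinates is
  drawn from this fact as well.\<close>

lemma coord_integrable:
  assumes p: "p \<in> {..<n} \<times> {..<n}"
  shows "integrable (gue_param_measure n) (\<lambda>x. x p)"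
proof -
  let ?M = "\<lambda>p. density lborel (normal_density 0 (gue_sd p))"
  have "integrable (?M p) (\<lambda>t. t)"
    using integrable_normal_moment_nz_1[OF gue_sd_pos[of p], of 0] by (subst integrable_density) auto
  moreover have "?M p = distr (gue_param_measure n) (?M p) (\<lambda>x. x p)"
    unfolding gue_param_measure_eq
    by (rule distr_PiM_component[symmetric, OF _ p]) (intro prob_space_normal_density gue_sd_pos)
  ultimately have "integrable (distr (gue_param_measure n) (?M p) (\<lambda>x. x p)) (\<lambda>t. t)" by simp
  thus ?thesis
    by (subst (asm) integrable_distr_eq) (use p in \<open>auto simp: gue_param_measure_eq intro!: measurable_component_singleton\<close>)
qed

lemma coord_mult_integrable:
  assumes p: "p \<in> {..<n} \<times> {..<n}" and f: "tame n f"
  shows "integrable (gue_param_measure n) (\<lambda>x. complex_of_real (x p) * f x)"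
proof -
  obtain B where B: "\<And>x. norm (f x) \<le> B" using f unfolding tame_def by blast
  have [measurable]: "(\<lambda>x. x p) \<in> borel_measurable (gue_param_measure n)" "f \<in> borel_measurable (gue_param_measure n)"
    using coord_integrable[OF p] f by (auto simp: tame_def)
  show ?thesis
  proof (rule Bochner_Integration.integrable_bound)
    show "integrable (gue_param_measure n) (\<lambda>x. B * x p)" using coord_integrable[OF p] by simp
    show "AE x in gue_param_measure n. norm (complex_of_real (x p) * f x) \<le> norm (B * x p)"
    proof (intro AE_I2)
      fix x
      have "norm (complex_of_real (x p) * f x) \<le> \<bar>x p\<bar> * \<bar>B\<bar>"
        unfolding norm_mult norm_of_real by (intro mult_left_mono order_trans[OF B]) auto
      thus "norm (complex_of_real (x p) * f x) \<le> norm (B * x p)" by (simp add: abs_mult mult.commute)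
    qed
  qed simp
qed

text \<open>Differentiability is asked for along whole lines \<open>x(p := t)\<close>, the form in
  which the inner integral appears once Fubini has isolated coordinate \<open>p\<close>.\<close>

definition has_partial ::
    "nat \<times> nat \<Rightarrow> (((nat \<times> nat) \<Rightarrow> real) \<Rightarrow> complex) \<Rightarrow> (((nat \<times> nat) \<Rightarrow> real) \<Rightarrow> complex) \<Rightarrow> bool" where
  "has_partial p f f' \<longleftrightarrow>
     (\<forall>x t. ((\<lambda>t. f (x(p := t))) has_vector_derivative f' (x(p := t))) (at t))"

text \<open>Fubini splits off coordinate \<open>p\<close>, and the one-dimensional identity applies
  on each line parallel to that axis.\<close>

lemma gue_ibp:
  assumes p: "p \<in> {..<n} \<times> {..<n}" and f: "tame n f" and f': "tame n f'" and d: "has_partial p f f'"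
  shows "(\<integral>x. complex_of_real (x p) * f x \<partial>gue_param_measure n)
       = complex_of_real ((gue_sd p)\<^sup>2) * (\<integral>x. f' x \<partial>gue_param_measure n)"
proof -
  let ?M = "\<lambda>p. density lborel (normal_density 0 (gue_sd p))"
  define I where "I = {..<n} \<times> {..<n} - {p}"
  have I: "finite I" "p \<notin> I" "insert p I = {..<n} \<times> {..<n}" using p by (auto simp: I_def)
  interpret product_sigma_finite ?M
    by unfold_locales
      (metis gue_sd_pos prob_space_normal_density prob_space_imp_sigma_finite sigma_finite_measure.sigma_finite_countable)
  have eq: "gue_param_measure n = PiM (insert p I) ?M" by (simp add: gue_param_measure_eq I)
  obtain B where B: "\<And>x. norm (f x) \<le> B" using f unfolding tame_def by blast
  obtain B' where B': "\<And>x. norm (f' x) \<le> B'" using f' unfolding tame_def by blast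
  have "(\<integral>x. complex_of_real (x p) * f x \<partial>gue_param_measure n)
      = (\<integral>x. (\<integral>t. complex_of_real t * f (x(p := t)) \<partial>?M p) \<partial>PiM I ?M)"
    using product_integral_insert[OF I(1,2), of "\<lambda>x. complex_of_real (x p) * f x"] coord_mult_integrable[OF p f]
    by (simp add: eq)
  also have "\<dots> = (\<integral>x. complex_of_real ((gue_sd p)\<^sup>2) * (\<integral>t. f' (x(p := t)) \<partial>?M p) \<partial>PiM I ?M)"
    using d f' by (intro Bochner_Integration.integral_cong refl gaussian_ibp_line[OF gue_sd_pos _ _ B B'])
      (auto simp: has_partial_def tame_def simp del: split_paired_All)
  also have "\<dots> = complex_of_real ((gue_sd p)\<^sup>2) * (\<integral>x. f' x \<partial>gue_param_measure n)"
    using product_integral_insert[OF I(1,2), of f'] tame_integrable[OF f'] by (simp add: eq)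
  finally show ?thesis .
qed

subsection \<open>Covariance of the matrix entries and the resolvent\<close>

text \<open>The matrix entries are real-linear in the coordinates, so evaluating \<open>gue_entry\<close> at a unit vector
  gives the derivative of the matrix in that coordinate.\<close>

definition gue_dir_entry :: "nat \<times> nat \<Rightarrow> nat \<Rightarrow> nat \<Rightarrow> complex" where
  "gue_dir_entry p = gue_entry (\<lambda>q. if q = p then 1 else 0)"

definition gue_dir :: "nat \<Rightarrow> nat \<times> nat \<Rightarrow> complex mat" where
  "gue_dir n p = mat n n (\<lambda>(a, b). gue_dir_entry p a b)"

lemma gue_dir_carrier[simp]: "gue_dir n p \<in> carrier_mat n n"
  by (simp add: gue_dir_def)

lemma gue_entry_upd:
  "gue_entry (x(p := t)) a b = gue_entry (x(p := s)) a b + complex_of_real (t - s) * gue_dir_entry p a b"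
  unfolding gue_dir_entry_def gue_entry_def by (auto simp: complex_eq_iff)

lemma gue_dir_entry_diag: "gue_dir_entry p a a = (if p = (a, a) then 1 else 0)"
  unfolding gue_dir_entry_def gue_entry_def by auto

lemma gue_dir_entry_upper:
  "a < b \<Longrightarrow> gue_dir_entry p a b = (if p = (a, b) then 1 else 0) + \<i> * (if p = (b, a) then 1 else 0)"
  unfolding gue_dir_entry_def gue_entry_def by (auto simp: complex_eq_iff)

lemma gue_dir_entry_lower:
  "b < a \<Longrightarrow> gue_dir_entry p a b = (if p = (b, a) then 1 else 0) + (- \<i>) * (if p = (a, b) then 1 else 0)"
  unfolding gue_dir_entry_def gue_entry_def by (auto simp: complex_eq_iff)

text \<open>A matrix entry involves at most two coordinates, its real and imaginary parts, so sums
  over all coordinates collapse to two terms. The factor \<open>k\<close> is \<open>\<i>\<close>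
  above the diagonal, \<open>- \<i>\<close> below it and 0 on it.\<close>

lemma sum_two_deltas:
  fixes h :: "'a \<Rightarrow> complex"
  assumes "finite P" "u \<in> P" "v \<in> P"
  shows "(\<Sum>p\<in>P. h p * ((if p = u then 1 else 0) + k * (if p = v then 1 else 0))) = h u + k * h v"
proof -
  have "(\<Sum>p\<in>P. h p * ((if p = u then 1 else 0) + k * (if p = v then 1 else 0)))
      = (\<Sum>p\<in>P. if p = u then h p else 0) + (\<Sum>p\<in>P. if p = v then k * h p else 0)"
    unfolding sum.distrib[symmetric] by (intro sum.cong) (auto simp: distrib_left)
  thus ?thesis using assms by (simp add: sum.delta)
qed

lemma gue_entry_decomp:
  assumes "a < n" "b < n"
  shows "gue_entry x a b = (\<Sum>p\<in>{..<n}\<times>{..<n}. complex_of_real (x p) * gue_dir_entry p a b)"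
proof -
  have fin: "finite ({..<n} \<times> {..<n})" by simp
  consider "a = b" | "a < b" | "b < a" by linarith
  thus ?thesis
  proof cases
    case 1
    show ?thesis
      using sum_two_deltas[OF fin, of "(a, a)" "(a, a)" "\<lambda>p. complex_of_real (x p)" 0] assms 1
      by (simp add: gue_dir_entry_diag gue_entry_def del: mult_cancel_left)
  next
    case 2
    show ?thesis
      using sum_two_deltas[OF fin, of "(a, b)" "(b, a)" "\<lambda>p. complex_of_real (x p)" \<i>] assms 2
      by (simp add: gue_dir_entry_upper gue_entry_def Complex_eq)
  next
    case 3
    show ?thesis
      using sum_two_deltas[OF fin, of "(b, a)" "(a, b)" "\<lambda>p. complex_of_real (x p)" "- \<i>"] assms 3
      by (simp add: gue_dir_entry_lower gue_entry_def Complex_eq)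
  qed
qed

text \<open>This is the covariance E(a_ab a_cd) of the unscaled entries. Off the diagonal, real and
  imaginary parts have variance 1/2: for (c,d) = (a,b) they contribute 1/2 - 1/2 = 0, for (c,d) =
  (b,a) they contribute 1/2 + 1/2 = 1.\<close>

lemma gue_covariance:
  assumes "a < n" "b < n"
  shows "(\<Sum>p\<in>{..<n}\<times>{..<n}. complex_of_real ((gue_sd p)\<^sup>2) * (gue_dir_entry p a b * gue_dir_entry p c d))
       = (if a = d \<and> b = c then 1 else 0)"
proof -
  have fin: "finite ({..<n} \<times> {..<n})" by simp
  define h where "h p = complex_of_real ((gue_sd p)\<^sup>2) * gue_dir_entry p c d" for p
  have h: "(\<Sum>p\<in>{..<n}\<times>{..<n}. complex_of_real ((gue_sd p)\<^sup>2) * (gue_dir_entry p a b * gue_dir_entry p c d))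
      = (\<Sum>p\<in>{..<n}\<times>{..<n}. h p * gue_dir_entry p a b)"
    by (simp add: h_def mult_ac)
  consider "a = b" | "a < b" | "b < a" by linarith
  thus ?thesis
  proof cases
    case 1
    have eq: "(\<Sum>p\<in>{..<n}\<times>{..<n}. h p * gue_dir_entry p a b) = h (a, a)"
      using sum_two_deltas[OF fin, of "(a, a)" "(a, a)" h 0] assms 1
      by (simp add: gue_dir_entry_diag)
    show ?thesis unfolding h eq using 1
      by (auto simp: h_def gue_sd_def gue_dir_entry_def gue_entry_def Complex_eq)
  next
    case 2
    have eq: "(\<Sum>p\<in>{..<n}\<times>{..<n}. h p * gue_dir_entry p a b) = h (a, b) + \<i> * h (b, a)"
      using sum_two_deltas[OF fin, of "(a, b)" "(b, a)" h \<i>] assms 2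
      by (simp add: gue_dir_entry_upper)
    show ?thesis unfolding h eq using 2
      by (auto simp: h_def gue_sd_def gue_dir_entry_def gue_entry_def complex_eq_iff real_sqrt_divide power_divide)
  next
    case 3
    have eq: "(\<Sum>p\<in>{..<n}\<times>{..<n}. h p * gue_dir_entry p a b) = h (b, a) + (- \<i>) * h (a, b)"
      using sum_two_deltas[OF fin, of "(b, a)" "(a, b)" h "- \<i>"] assms 3
      by (simp add: gue_dir_entry_lower)
    show ?thesis unfolding h eq using 3
      by (auto simp: h_def gue_sd_def gue_dir_entry_def gue_entry_def complex_eq_iff real_sqrt_divide power_divide)
  qed
qed

section \<open>Traces and their contraction by the covariance\<close>

lemma mat_mult_entry:
  assumes "A \<in> carrier_mat n n" "B \<in> carrier_mat n n" "i < n" "j < n"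
  shows "(A * B) $$ (i, j) = (\<Sum>k<n. A $$ (i, k) * B $$ (k, j))"
  using assms by (simp add: scalar_prod_def atLeast0LessThan)

lemma mtrace_carrier: "A \<in> carrier_mat n n \<Longrightarrow> mtrace A = (\<Sum>i<n. A $$ (i, i))"
  by (simp add: mtrace_def)

lemma mtrace_mult:
  assumes "A \<in> carrier_mat n n" "B \<in> carrier_mat n n"
  shows "mtrace (A * B) = (\<Sum>i<n. \<Sum>k<n. A $$ (i, k) * B $$ (k, i))"
  using assms by (subst mtrace_carrier[of _ n]) (auto simp: mat_mult_entry simp del: index_mult_mat)

lemma mtrace_comm:
  assumes "A \<in> carrier_mat n n" "B \<in> carrier_mat n n"
  shows "mtrace (A * B) = mtrace (B * A)"
  unfolding mtrace_mult[OF assms] mtrace_mult[OF assms(2,1)] by (subst sum.swap) (simp add: mult.commute)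

text \<open>Expanding the trace gives terms h_ab X_bc h_cd Y_da. The covariance forces d = a and c =
  b, and the remaining sum of X_bb Y_aa factorises: a contraction inside one trace splits it in
  two.\<close>

lemma gue_contract_one:
  assumes X: "X \<in> carrier_mat n n" and Y: "Y \<in> carrier_mat n n"
  shows "(\<Sum>p\<in>{..<n}\<times>{..<n}. complex_of_real ((gue_sd p)\<^sup>2) * mtrace (gue_dir n p * (X * (gue_dir n p * Y))))
       = mtrace X * mtrace Y"
proof -
  let ?P = "{..<n}\<times>{..<n}"
  let ?s = "\<lambda>p. complex_of_real ((gue_sd p)\<^sup>2)" and ?h = gue_dir_entry
  have tr: "mtrace (gue_dir n p * (X * (gue_dir n p * Y)))
      = (\<Sum>a<n. \<Sum>b<n. \<Sum>c<n. \<Sum>d<n. (?h p a b * ?h p c d) * (X $$ (b, c) * Y $$ (d, a)))" for p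
  proof -
    have H: "gue_dir n p $$ (a, b) = ?h p a b" if "a < n" "b < n" for a b
      using that by (simp add: gue_dir_def)
    have HY: "(gue_dir n p * Y) $$ (c, a) = (\<Sum>d<n. ?h p c d * Y $$ (d, a))" if "c < n" "a < n" for a c
      unfolding mat_mult_entry[OF gue_dir_carrier Y that] using that by (intro sum.cong) (auto simp: H)
    have XHY: "(X * (gue_dir n p * Y)) $$ (b, a) = (\<Sum>c<n. X $$ (b, c) * (\<Sum>d<n. ?h p c d * Y $$ (d, a)))"
      if "b < n" "a < n" for a b
      unfolding mat_mult_entry[OF X mult_carrier_mat[OF gue_dir_carrier Y] that] using that
      by (intro sum.cong) (auto simp: HY simp del: index_mult_mat)
    have "mtrace (gue_dir n p * (X * (gue_dir n p * Y)))
        = (\<Sum>a<n. \<Sum>b<n. ?h p a b * (\<Sum>c<n. X $$ (b, c) * (\<Sum>d<n. ?h p c d * Y $$ (d, a))))"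
      unfolding mtrace_mult[OF gue_dir_carrier mult_carrier_mat[OF X mult_carrier_mat[OF gue_dir_carrier Y]]]
      by (intro sum.cong) (auto simp: XHY H simp del: index_mult_mat)
    thus ?thesis by (simp only: sum_distrib_left mult_ac)
  qed
  have "(\<Sum>p\<in>?P. ?s p * mtrace (gue_dir n p * (X * (gue_dir n p * Y))))
      = (\<Sum>a<n. \<Sum>b<n. \<Sum>c<n. \<Sum>d<n. (\<Sum>p\<in>?P. ?s p * (?h p a b * ?h p c d)) * (X $$ (b, c) * Y $$ (d, a)))"
    \<comment> \<open>Fixing both index sets orients \<open>sum.swap\<close>: only the sum over
      \<open>p\<close> moves inwards, where the covariance evaluates it.\<close>
    unfolding tr sum_distrib_left sum_distrib_right sum.swap[where A = ?P and B = "{..<n}"]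
    by (simp only: mult.assoc)
  also have "\<dots> = (\<Sum>a<n. \<Sum>b<n. \<Sum>c<n. \<Sum>d<n. (if d = a then if c = b then X $$ (b, c) * Y $$ (d, a) else 0 else 0))"
    by (intro sum.cong refl) (simp add: gue_covariance del: of_real_power)
  also have "\<dots> = mtrace X * mtrace Y"
    unfolding mtrace_carrier[OF X] mtrace_carrier[OF Y] sum_product by (subst sum.swap) (simp add: sum.delta)
  finally show ?thesis .
qed

text \<open>Here the terms are h_ab X_ba h_cd Y_dc. Forcing d = a and c = b leaves X_ba Y_ab, so a
  contraction between two traces merges them into one.\<close>

lemma gue_contract_two:
  assumes X: "X \<in> carrier_mat n n" and Y: "Y \<in> carrier_mat n n"
  shows "(\<Sum>p\<in>{..<n}\<times>{..<n}. complex_of_real ((gue_sd p)\<^sup>2) * (mtrace (gue_dir n p * X) * mtrace (gue_dir n p * Y)))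
       = mtrace (X * Y)"
proof -
  let ?P = "{..<n}\<times>{..<n}"
  let ?s = "\<lambda>p. complex_of_real ((gue_sd p)\<^sup>2)" and ?h = gue_dir_entry
  have tr: "mtrace (gue_dir n p * X) * mtrace (gue_dir n p * Y)
      = (\<Sum>a<n. \<Sum>b<n. \<Sum>c<n. \<Sum>d<n. (?h p a b * ?h p c d) * (X $$ (b, a) * Y $$ (d, c)))" for p
  proof -
    have "mtrace (gue_dir n p * X) = (\<Sum>a<n. \<Sum>b<n. ?h p a b * X $$ (b, a))"
      using X by (subst mtrace_mult[of _ n]) (auto simp: gue_dir_def)
    moreover have "mtrace (gue_dir n p * Y) = (\<Sum>c<n. \<Sum>d<n. ?h p c d * Y $$ (d, c))"
      using Y by (subst mtrace_mult[of _ n]) (auto simp: gue_dir_def)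
    ultimately show ?thesis
      by (simp only: sum_distrib_right) (simp only: sum_distrib_left mult_ac)
  qed
  have "(\<Sum>p\<in>?P. ?s p * (mtrace (gue_dir n p * X) * mtrace (gue_dir n p * Y)))
      = (\<Sum>a<n. \<Sum>b<n. \<Sum>c<n. \<Sum>d<n. (\<Sum>p\<in>?P. ?s p * (?h p a b * ?h p c d)) * (X $$ (b, a) * Y $$ (d, c)))"
    unfolding tr sum_distrib_left sum_distrib_right sum.swap[where A = ?P and B = "{..<n}"]
    by (simp only: mult.assoc)
  also have "\<dots> = (\<Sum>a<n. \<Sum>b<n. \<Sum>c<n. \<Sum>d<n. (if d = a then if c = b then X $$ (b, a) * Y $$ (d, c) else 0 else 0))"
    by (intro sum.cong refl) (simp add: gue_covariance del: of_real_power)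
  also have "\<dots> = mtrace (X * Y)"
    unfolding mtrace_mult[OF X Y] by (subst sum.swap) (simp add: sum.delta)
  finally show ?thesis .
qed

section \<open>Invertibility off the real axis and bounds on the resolvent\<close>

lemma hermitian_form_Im:
  fixes M :: "nat \<Rightarrow> nat \<Rightarrow> complex"
  assumes "\<And>a b. M b a = cnj (M a b)"
  shows "Im (\<Sum>a<n. \<Sum>b<n. cnj (v a) * (M a b * v b)) = 0"
proof -
  let ?S = "\<Sum>a<n. \<Sum>b<n. cnj (v a) * (M a b * v b)"
  have "cnj ?S = (\<Sum>a<n. \<Sum>b<n. v a * (cnj (M a b) * cnj (v b)))" by simp
  \<comment> \<open>Exchanging the two indices and using the Hermitian symmetry turns the conjugate
    back into the form itself, which is therefore real.\<close>
  also have "\<dots> = (\<Sum>b<n. \<Sum>a<n. v a * (cnj (M a b) * cnj (v b)))" by (rule sum.swap)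
  also have "\<dots> = ?S" by (simp add: assms[symmetric] mult_ac)
  finally have "Im (cnj ?S) = Im ?S" by (rule arg_cong)
  moreover have "Im (cnj ?S) = - Im ?S" by (rule cnj.sel(2))
  ultimately show ?thesis by linarith
qed

text \<open>Pair (M - w)v = u with the conjugate of v and take imaginary parts; the Hermitian form
  drops out. Taking u = 0 yields invertibility, and taking u a basis vector yields the bound on
  resolvent entries.\<close>

lemma ward_identity:
  fixes M :: "nat \<Rightarrow> nat \<Rightarrow> complex"
  assumes herm: "\<And>a b. M b a = cnj (M a b)"
    and eq: "\<And>a. a < n \<Longrightarrow> (\<Sum>b<n. M a b * v b) - w * v a = u a"
  shows "Im (\<Sum>a<n. cnj (v a) * u a) = - Im w * (\<Sum>a<n. (cmod (v a))\<^sup>2)"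
proof -
  have "(\<Sum>a<n. cnj (v a) * u a) = (\<Sum>a<n. cnj (v a) * ((\<Sum>b<n. M a b * v b) - w * v a))"
    by (simp add: eq)
  also have "\<dots> = (\<Sum>a<n. \<Sum>b<n. cnj (v a) * (M a b * v b)) - w * (\<Sum>a<n. v a * cnj (v a))"
    by (simp add: right_diff_distrib sum_subtractf sum_distrib_left mult_ac)
  also have "(\<Sum>a<n. v a * cnj (v a)) = complex_of_real (\<Sum>a<n. (cmod (v a))\<^sup>2)"
    by (simp only: of_real_sum complex_norm_square)
  finally show ?thesis using hermitian_form_Im[OF herm, where v = v and n = n] by simp
qed

definition spectral_point :: "nat \<Rightarrow> complex \<Rightarrow> complex" where
  "spectral_point n z = 2 + z * complex_of_real (real n powr (-2/3))"

definition gue_shifted :: "nat \<Rightarrow> complex \<Rightarrow> ((nat \<times> nat) \<Rightarrow> real) \<Rightarrow> complex mat" where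
  "gue_shifted n z x = gue_matrix n x - spectral_point n z \<cdot>\<^sub>m 1\<^sub>m n"

lemma gue_shifted_carrier[simp]: "gue_shifted n z x \<in> carrier_mat n n"
  by (simp add: gue_shifted_def gue_matrix_def minus_carrier_mat)

text \<open>Entries as a function on all index pairs, so that Hermitian symmetry holds without range
  conditions.\<close>

definition gue_scaled :: "nat \<Rightarrow> ((nat \<times> nat) \<Rightarrow> real) \<Rightarrow> nat \<Rightarrow> nat \<Rightarrow> complex" where
  "gue_scaled n x a b = gue_entry x a b / complex_of_real (sqrt (real n))"

lemma gue_scaled_hermitian: "gue_scaled n x b a = cnj (gue_scaled n x a b)"
  unfolding gue_scaled_def gue_entry_def by (auto simp: complex_eq_iff)

lemma gue_shifted_entry:
  "a < n \<Longrightarrow> b < n \<Longrightarrow>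
     gue_shifted n z x $$ (a, b) = gue_scaled n x a b - (if a = b then spectral_point n z else 0)"
  by (simp add: gue_shifted_def gue_matrix_def gue_scaled_def)

lemma gue_shifted_apply:
  assumes "a < n"
  shows "(\<Sum>b<n. gue_shifted n z x $$ (a, b) * v b)
       = (\<Sum>b<n. gue_scaled n x a b * v b) - spectral_point n z * v a"
proof -
  have "(\<Sum>b<n. gue_shifted n z x $$ (a, b) * v b)
      = (\<Sum>b<n. gue_scaled n x a b * v b) - (\<Sum>b<n. if b = a then spectral_point n z * v b else 0)"
    unfolding sum_subtractf[symmetric] using assms
    by (intro sum.cong refl) (auto simp: gue_shifted_entry left_diff_distrib)
  thus ?thesis using assms by (simp add: sum.delta)
qed

context
  fixes n :: nat and z :: complex
  assumes n: "0 < n" and z: "Im z \<noteq> 0"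
begin

lemma spectral_point_Im: "Im (spectral_point n z) \<noteq> 0"
  using n z by (simp add: spectral_point_def)

text \<open>A kernel vector satisfies the Ward identity with right-hand side 0; as the imaginary
  part of \<open>spectral_point n z\<close> is nonzero, its norm vanishes.\<close>

lemma det_gue_shifted: "Determinant.det (gue_shifted n z x) \<noteq> 0"
proof
  assume "Determinant.det (gue_shifted n z x) = 0"
  then obtain v where v: "v \<in> carrier_vec n" "v \<noteq> 0\<^sub>v n" "gue_shifted n z x *\<^sub>v v = 0\<^sub>v n"
    using det_0_iff_vec_prod_zero_field[OF gue_shifted_carrier] by blast
  have "(\<Sum>b<n. gue_scaled n x a b * v $ b) - spectral_point n z * v $ a = 0" if a: "a < n" for a
  proof -
    have "(gue_shifted n z x *\<^sub>v v) $ a = (\<Sum>b<n. gue_shifted n z x $$ (a, b) * v $ b)"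
      using a v(1) carrier_matD[OF gue_shifted_carrier[of n z x]]
      by (simp add: scalar_prod_def atLeast0LessThan)
    thus ?thesis using a v(3) gue_shifted_apply[OF a, of z x "\<lambda>b. v $ b"] by simp
  qed
  from ward_identity[where M = "gue_scaled n x" and v = "\<lambda>b. v $ b" and u = "\<lambda>_. 0", OF gue_scaled_hermitian this]
  have "(\<Sum>a<n. (cmod (v $ a))\<^sup>2) = 0" using spectral_point_Im by simp
  hence "\<forall>a<n. v $ a = 0" by (subst (asm) sum_nonneg_eq_0_iff) auto
  with v(1,2) show False by (auto intro: eq_vecI)
qed

lemma resolvent_inverse:
  shows "resolvent n z x \<in> carrier_mat n n"
    and "gue_shifted n z x * resolvent n z x = 1\<^sub>m n"
    and "resolvent n z x * gue_shifted n z x = 1\<^sub>m n"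
proof -
  have r: "resolvent n z x = the (mat_inverse (gue_shifted n z x))"
    by (simp add: resolvent_def gue_shifted_def spectral_point_def)
  have "mat_inverse (gue_shifted n z x) \<noteq> None"
    \<comment> \<open>The value \<open>()\<close> fills the record extension of the matrix ring, so
      that both facts speak of units of the same ring.\<close>
    using mat_inverse(1)[OF gue_shifted_carrier, of n z x "()"]
      det_non_zero_imp_unit[OF gue_shifted_carrier det_gue_shifted, of x "()"]
    by blast
  then obtain B where "mat_inverse (gue_shifted n z x) = Some B" by blast
  thus "resolvent n z x \<in> carrier_mat n n"
    "gue_shifted n z x * resolvent n z x = 1\<^sub>m n"
    "resolvent n z x * gue_shifted n z x = 1\<^sub>m n"
    using mat_inverse(2)[OF gue_shifted_carrier, of n z x B] by (simp_all add: r)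
qed

text \<open>Column j of the resolvent solves (A - w)v = e_j, so the Ward identity bounds |Im w|
  times the squared norm of v by |v_j|. This first bounds v_j itself by 1/|Im w|; inserted again, it
  bounds every v_i. The bound is uniform in \<open>x\<close>, as \<open>tame\<close>
  requires.\<close>

lemma resolvent_entry_bound:
  assumes i: "i < n" and j: "j < n"
  shows "cmod (resolvent n z x $$ (i, j)) \<le> 1 / \<bar>Im (spectral_point n z)\<bar>"
proof -
  let ?w = "spectral_point n z"
  define v where "v a = resolvent n z x $$ (a, j)" for a
  define S where "S = (\<Sum>a<n. (cmod (v a))\<^sup>2)"
  have eq: "(\<Sum>b<n. gue_scaled n x a b * v b) - ?w * v a = (if a = j then 1 else 0)" if a: "a < n" for a
    using mat_mult_entry[OF gue_shifted_carrier resolvent_inverse(1) a j, of z x x] a j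
    unfolding resolvent_inverse(2) by (simp add: gue_shifted_apply v_def)
  have "(\<Sum>a<n. cnj (v a) * (if a = j then 1 else 0)) = (\<Sum>a<n. if a = j then cnj (v a) else 0)"
    by (intro sum.cong) auto
  also have "\<dots> = cnj (v j)" using j by (simp add: sum.delta)
  finally have "Im (cnj (v j)) = - Im ?w * S"
    using ward_identity[where M = "gue_scaled n x" and v = v and n = n, OF gue_scaled_hermitian eq]
    by (simp add: S_def)
  hence "\<bar>Im ?w\<bar> * S \<le> cmod (v j)"
    using abs_Im_le_cmod[of "v j"] by (simp add: abs_mult S_def sum_nonneg)
  moreover have sq_le: "(cmod (v a))\<^sup>2 \<le> S" if "a < n" for a
    unfolding S_def using that by (intro member_le_sum) auto
  ultimately have j_le: "\<bar>Im ?w\<bar> * (cmod (v a))\<^sup>2 \<le> cmod (v j)" if "a < n" for a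
    using that by (meson abs_ge_zero mult_left_mono order_trans)
  have wpos: "0 < \<bar>Im ?w\<bar>" using spectral_point_Im by simp
  have vj: "cmod (v j) \<le> 1 / \<bar>Im ?w\<bar>"
  proof (cases "cmod (v j) = 0")
    case False
    have "(\<bar>Im ?w\<bar> * cmod (v j)) * cmod (v j) \<le> 1 * cmod (v j)"
      using j_le[OF j] by (simp add: power2_eq_square)
    hence "\<bar>Im ?w\<bar> * cmod (v j) \<le> 1"
      using False by (simp only: mult_le_cancel_right) auto
    thus ?thesis using wpos by (simp add: field_simps)
  qed simp
  have "(cmod (v i))\<^sup>2 \<le> (1 / \<bar>Im ?w\<bar>) / \<bar>Im ?w\<bar>"
    using order_trans[OF j_le[OF i] vj] by (simp only: pos_le_divide_eq[OF wpos] mult.commute)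
  also have "\<dots> = (1 / \<bar>Im ?w\<bar>)\<^sup>2" by (simp add: power2_eq_square)
  finally show ?thesis using power2_le_imp_le[of "cmod (v i)" "1 / \<bar>Im ?w\<bar>"] by (simp add: v_def)
qed

lemma gue_shifted_upd:
  "gue_shifted n z (x(p := t)) =
     gue_shifted n z (x(p := s)) + complex_of_real ((t - s) / sqrt (real n)) \<cdot>\<^sub>m gue_dir n p"
proof (rule eq_matI)
  fix i j assume "i < dim_row (gue_shifted n z (x(p := s)) + complex_of_real ((t - s) / sqrt (real n)) \<cdot>\<^sub>m gue_dir n p)"
    "j < dim_col (gue_shifted n z (x(p := s)) + complex_of_real ((t - s) / sqrt (real n)) \<cdot>\<^sub>m gue_dir n p)"
  hence ij: "i < n" "j < n" by (auto simp: gue_dir_def)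
  thus "gue_shifted n z (x(p := t)) $$ (i, j)
    = (gue_shifted n z (x(p := s)) + complex_of_real ((t - s) / sqrt (real n)) \<cdot>\<^sub>m gue_dir n p) $$ (i, j)"
    using gue_entry_upd[of x p t i j s] n
    by (simp add: gue_shifted_entry gue_dir_def gue_scaled_def add_divide_distrib)
qed (use carrier_matD[OF gue_shifted_carrier[of n z]] in \<open>auto simp: gue_dir_def\<close>)

text \<open>The second resolvent identity for matrices differing by a multiple of
  \<open>gue_dir n p\<close>. Being exact for finite increments, it supplies first continuity and
  then the derivative along a coordinate.\<close>

lemma resolvent_diff:
  assumes i: "i < n" and j: "j < n"
  shows "resolvent n z (x(p := t)) $$ (i, j) - resolvent n z (x(p := s)) $$ (i, j)
    = complex_of_real (t - s) * (- (1 / complex_of_real (sqrt (real n))) *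
        (resolvent n z (x(p := t)) * (gue_dir n p * resolvent n z (x(p := s)))) $$ (i, j))"
proof -
  let ?Gt = "resolvent n z (x(p := t))" and ?Gs = "resolvent n z (x(p := s))"
  let ?Wt = "gue_shifted n z (x(p := t))" and ?Ws = "gue_shifted n z (x(p := s))"
  let ?c = "complex_of_real ((t - s) / sqrt (real n))" and ?H = "gue_dir n p"
  let ?HG = "?H * ?Gs"
  note Gt = resolvent_inverse(1)[of "x(p := t)"] and Gs = resolvent_inverse(1)[of "x(p := s)"]
  have HG: "?HG \<in> carrier_mat n n" by (rule mult_carrier_mat[OF gue_dir_carrier Gs])
  have "?Wt * ?Gs = ?Ws * ?Gs + ?c \<cdot>\<^sub>m ?H * ?Gs"
    unfolding gue_shifted_upd[of x p t s] by (rule add_mult_distrib_mat[OF gue_shifted_carrier smult_carrier_mat[OF gue_dir_carrier] Gs])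
  also have "\<dots> = 1\<^sub>m n + ?c \<cdot>\<^sub>m ?HG"
    using mult_smult_assoc_mat[OF gue_dir_carrier Gs] by (simp only: resolvent_inverse)
  finally have WG: "?Wt * ?Gs = 1\<^sub>m n + ?c \<cdot>\<^sub>m ?HG" .
  have "?Gs = ?Gt * ?Wt * ?Gs"
    by (simp add: resolvent_inverse(3) left_mult_one_mat[OF Gs])
  also have "\<dots> = ?Gt * (?Wt * ?Gs)"
    by (rule assoc_mult_mat[OF Gt gue_shifted_carrier Gs])
  also have "\<dots> = ?Gt * 1\<^sub>m n + ?Gt * (?c \<cdot>\<^sub>m ?HG)"
    unfolding WG using Gt HG by (intro mult_add_distrib_mat) auto
  also have "\<dots> = ?Gt + ?c \<cdot>\<^sub>m (?Gt * ?HG)"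
    using mult_smult_distrib[OF Gt HG] Gt by simp
  finally have "?Gs $$ (i, j) = (?Gt + ?c \<cdot>\<^sub>m (?Gt * (?H * ?Gs))) $$ (i, j)" by simp
  also have "\<dots> = ?Gt $$ (i, j) + ?c * (?Gt * (?H * ?Gs)) $$ (i, j)"
    using i j carrier_matD[OF resolvent_inverse(1)] by (simp del: index_mult_mat(1))
  finally show ?thesis by (simp add: field_simps)
qed

end

subsection \<open>Derivatives of resolvent traces\<close>

text \<open>Caratheodory's criterion: a difference quotient that extends continuously to
  \<open>s\<close> has the derivative as its value there.\<close>

lemma has_vector_derivative_difference_quotient:
  fixes f :: "real \<Rightarrow> 'a::real_normed_vector"
  assumes eq: "\<And>t. f t - f s = (t - s) *\<^sub>R g t" and g: "isCont g s"
  shows "(f has_vector_derivative g s) (at s)"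
  unfolding has_vector_derivative_def has_derivative_iff_norm
proof
  show "bounded_linear (\<lambda>x. x *\<^sub>R g s)" by (rule bounded_linear_scaleR_left)
  have "((\<lambda>t. norm (g t - g s)) \<longlongrightarrow> 0) (at s)"
    using g by (simp add: isCont_def LIM_zero tendsto_norm_zero)
  moreover have "\<forall>\<^sub>F t in at s. norm (g t - g s) = norm (f t - f s - (t - s) *\<^sub>R g s) / norm (t - s)"
    by (auto simp: eventually_at_filter eq scaleR_diff_right[symmetric])
  ultimately show "((\<lambda>t. norm (f t - f s - (t - s) *\<^sub>R g s) / norm (t - s)) \<longlongrightarrow> 0) (at s)"
    by (rule Lim_transform_eventually)
qed

lemma has_partial_const: "has_partial p (\<lambda>_. c) (\<lambda>_. 0)"
  unfolding has_partial_def by auto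

lemma has_partial_add:
  "has_partial p f f' \<Longrightarrow> has_partial p g g' \<Longrightarrow> has_partial p (\<lambda>x. f x + g x) (\<lambda>x. f' x + g' x)"
  unfolding has_partial_def by (auto intro: has_vector_derivative_add)

lemma has_partial_mult:
  "has_partial p f f' \<Longrightarrow> has_partial p g g' \<Longrightarrow>
     has_partial p (\<lambda>x. f x * g x) (\<lambda>x. f x * g' x + f' x * g x)"
  unfolding has_partial_def by (auto intro: has_vector_derivative_mult)

lemma has_partial_cmult:
  "has_partial p f f' \<Longrightarrow> has_partial p (\<lambda>x. c * f x) (\<lambda>x. c * f' x)"
  using has_partial_mult[OF has_partial_const] by simp

lemma has_partial_sum:
  "(\<And>i. i \<in> I \<Longrightarrow> has_partial p (f i) (f' i)) \<Longrightarrow>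
     has_partial p (\<lambda>x. \<Sum>i\<in>I. f i x) (\<lambda>x. \<Sum>i\<in>I. f' i x)"
  by (induction I rule: infinite_finite_induct) (auto intro: has_partial_add has_partial_const)

lemma has_partial_power:
  assumes "has_partial p f f'"
  shows "has_partial p (\<lambda>x. f x ^ k) (\<lambda>x. of_nat k * f x ^ (k - 1) * f' x)"
proof (induction k)
  case 0
  show ?case using has_partial_const[of p 1] by simp
next
  case (Suc k)
  have "(\<lambda>x. f x * (of_nat k * f x ^ (k - 1) * f' x) + f' x * f x ^ k)
      = (\<lambda>x. of_nat (Suc k) * f x ^ (Suc k - 1) * f' x)"
    \<comment> \<open>For \<open>k = 0\<close> the truncated exponent \<open>k - 1\<close> is
      harmless, since its term carries the factor 0.\<close>
    by (cases k) (auto simp: fun_eq_iff algebra_simps)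
  with has_partial_mult[OF assms Suc] show ?case by simp
qed

lemma has_partial_prod:
  assumes "finite I" "\<And>i. i \<in> I \<Longrightarrow> has_partial p (f i) (f' i)"
  shows "has_partial p (\<lambda>x. \<Prod>i\<in>I. f i x) (\<lambda>x. \<Sum>i\<in>I. f' i x * (\<Prod>j\<in>I - {i}. f j x))"
  using assms
proof (induction I)
  case empty
  show ?case using has_partial_const[of p 1] by simp
next
  case (insert a I)
  have "f a x * (\<Sum>i\<in>I. f' i x * (\<Prod>j\<in>I - {i}. f j x)) + f' a x * (\<Prod>i\<in>I. f i x)
      = (\<Sum>i\<in>insert a I. f' i x * (\<Prod>j\<in>insert a I - {i}. f j x))" for x
  proof -
    have "(\<Prod>j\<in>insert a I - {i}. f j x) = f a x * (\<Prod>j\<in>I - {i}. f j x)" if "i \<in> I" for i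
    proof -
      have "insert a I - {i} = insert a (I - {i})" using that insert.hyps by auto
      thus ?thesis using insert.hyps by simp
    qed
    thus ?thesis using insert.hyps
      by (simp add: sum_distrib_left mult.left_commute)
  qed
  moreover have "has_partial p (\<lambda>x. f a x * (\<Prod>i\<in>I. f i x))
      (\<lambda>x. f a x * (\<Sum>i\<in>I. f' i x * (\<Prod>j\<in>I - {i}. f j x)) + f' a x * (\<Prod>i\<in>I. f i x))"
    using insert by (intro has_partial_mult) auto
  ultimately show ?case using insert.hyps by (simp add: add.commute)
qed

section \<open>Matrix-valued regular functions, measurability and matrix powers\<close>

definition tame_mat :: "nat \<Rightarrow> (((nat \<times> nat) \<Rightarrow> real) \<Rightarrow> complex mat) \<Rightarrow> bool" where
  "tame_mat n A \<longleftrightarrow> (\<forall>x. A x \<in> carrier_mat n n) \<and> (\<forall>i<n. \<forall>j<n. tame n (\<lambda>x. A x $$ (i, j)))"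

lemma tame_mat_const: "A \<in> carrier_mat n n \<Longrightarrow> tame_mat n (\<lambda>_. A)"
  unfolding tame_mat_def by (auto intro: tame_const)

lemma tame_mat_mult:
  assumes A: "tame_mat n A" and B: "tame_mat n B"
  shows "tame_mat n (\<lambda>x. A x * B x)"
proof -
  have c: "A x \<in> carrier_mat n n" "B x \<in> carrier_mat n n" for x
    using A B by (auto simp: tame_mat_def)
  have "tame n (\<lambda>x. (A x * B x) $$ (i, j))" if "i < n" "j < n" for i j
    unfolding mat_mult_entry[OF c that] using A B that
    by (intro tame_sum tame_mult) (auto simp: tame_mat_def)
  thus ?thesis using mult_carrier_mat[OF c] by (auto simp: tame_mat_def)
qed

lemma tame_mat_pow: "tame_mat n A \<Longrightarrow> tame_mat n (\<lambda>x. A x ^\<^sub>m k)"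
proof (induction k)
  case 0
  hence "dim_row (A x) = n" for x by (auto simp: tame_mat_def)
  thus ?case by (simp add: tame_mat_const)
next
  case (Suc k)
  thus ?case by (simp add: tame_mat_mult)
qed

lemma tame_mtrace: "tame_mat n A \<Longrightarrow> tame n (\<lambda>x. mtrace (A x))"
proof -
  assume A: "tame_mat n A"
  hence c: "A x \<in> carrier_mat n n" for x by (simp add: tame_mat_def)
  show ?thesis unfolding mtrace_carrier[OF c] using A by (intro tame_sum) (auto simp: tame_mat_def)
qed

text \<open>By the Leibniz formula the determinant is a polynomial in the entries.\<close>

lemma measurable_det:
  assumes c: "\<And>x. A x \<in> carrier_mat m m"
    and meas: "\<And>i j. i < m \<Longrightarrow> j < m \<Longrightarrow> (\<lambda>x. A x $$ (i, j)) \<in> borel_measurable M"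
  shows "(\<lambda>x. Determinant.det (A x) :: complex) \<in> borel_measurable M"
  unfolding det_def'[OF c]
  by (intro borel_measurable_sum borel_measurable_times borel_measurable_prod borel_measurable_const meas)
     (auto simp: permutes_in_image)

lemma measurable_gue_scaled:
  assumes "a < n" "b < n"
  shows "(\<lambda>x. gue_scaled n x a b) \<in> borel_measurable (gue_param_measure n)"
proof -
  have [measurable]: "(\<lambda>x. x (i, j)) \<in> borel_measurable (gue_param_measure n)" if "i < n" "j < n" for i j
    using coord_integrable[of "(i, j)" n] that by auto
  show ?thesis
    unfolding gue_scaled_def gue_entry_def Complex_eq using assms by auto
qed

lemma pow_mat_add:
  assumes A: "A \<in> carrier_mat n n"
  shows "A ^\<^sub>m (a + b) = A ^\<^sub>m a * A ^\<^sub>m b"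
proof (induction b)
  case 0
  show ?case using A right_mult_one_mat[OF pow_carrier_mat[OF A]] by simp
next
  case (Suc b)
  thus ?case
    using assoc_mult_mat[OF pow_carrier_mat[OF A] pow_carrier_mat[OF A] A] by simp
qed

lemma pow_mat_one: "A \<in> carrier_mat n n \<Longrightarrow> A ^\<^sub>m Suc 0 = A"
  using left_mult_one_mat[of A n n] by simp

section \<open>Moments as integrals of monomials in one family of statistics\<close>

definition gue_stat :: "nat \<Rightarrow> complex \<Rightarrow> nat \<Rightarrow> ((nat \<times> nat) \<Rightarrow> real) \<Rightarrow> complex" where
  "gue_stat n z l x = (if l = 1 then gc_n1 n z x else g_nk n l z x)"

text \<open>The range \<open>{1..N}\<close> replaces the support of \<open>K\<close>, so that every
  moment in the recursion is an integral over one common index range; a factor with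
  \<open>K l = 0\<close> equals 1.\<close>

definition gue_monomial ::
    "nat \<Rightarrow> complex \<Rightarrow> nat \<Rightarrow> (nat \<Rightarrow> nat) \<Rightarrow> ((nat \<times> nat) \<Rightarrow> real) \<Rightarrow> complex" where
  "gue_monomial n z N K x = (\<Prod>l\<in>{1..N}. gue_stat n z l x ^ K l)"

lemma moment_eq_monomial:
  assumes N: "1 \<le> N" and supp: "\<And>l. N < l \<Longrightarrow> K l = 0"
  shows "moment n z K = (\<integral>x. gue_monomial n z N K x \<partial>gue_param_measure n)"
proof -
  have "gc_n1 n z x ^ K 1 * (\<Prod>l\<in>{l. 2 \<le> l \<and> K l \<noteq> 0}. g_nk n l z x ^ K l) = gue_monomial n z N K x" for x
  proof -
    have "(\<Prod>l\<in>{l. 2 \<le> l \<and> K l \<noteq> 0}. g_nk n l z x ^ K l) = (\<Prod>l\<in>{2..N}. gue_stat n z l x ^ K l)"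
    proof (rule prod.mono_neutral_cong_left)
      have "l \<le> N" if "K l \<noteq> 0" for l using supp[of l] that by linarith
      thus "{l. 2 \<le> l \<and> K l \<noteq> 0} \<subseteq> {2..N}" by auto
    qed (auto simp: gue_stat_def)
    moreover have "{1..N} = insert 1 {2..N}" using N by auto
    ultimately show ?thesis by (simp add: gue_monomial_def gue_stat_def)
  qed
  thus ?thesis by (simp add: moment_def)
qed

lemma gue_monomial_add_unit:
  assumes "l \<in> {1..N}"
  shows "gue_monomial n z N (\<lambda>i. K i + m * unit_mi l i) x = gue_stat n z l x ^ m * gue_monomial n z N K x"
proof -
  have "gue_monomial n z N (\<lambda>i. K i + m * unit_mi l i) x
      = gue_monomial n z N K x * (\<Prod>i\<in>{1..N}. if i = l then gue_stat n z i x ^ m else 1)"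
    unfolding gue_monomial_def prod.distrib[symmetric]
    by (intro prod.cong) (auto simp: unit_mi_def power_add)
  also have "(\<Prod>i\<in>{1..N}. if i = l then gue_stat n z i x ^ m else 1) = gue_stat n z l x ^ m"
    using assms by (simp add: prod.delta)
  finally show ?thesis by (simp add: mult.commute)
qed

lemma moment_add_unit:
  assumes N: "1 \<le> N" and supp: "\<And>l. N < l \<Longrightarrow> K l = 0" and l: "l \<in> {1..N}"
  shows "moment n z (\<lambda>i. K i + m * unit_mi l i)
       = (\<integral>x. gue_stat n z l x ^ m * gue_monomial n z N K x \<partial>gue_param_measure n)"
  unfolding gue_monomial_add_unit[OF l, symmetric]
  using supp l by (intro moment_eq_monomial[OF N]) (auto simp: unit_mi_def)

text \<open>The right-hand side is the shape produced by the product rule. If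
  \<open>K l = 0\<close>, truncated subtraction leaves \<open>K\<close> unchanged, and the term is
  later multiplied by \<open>K l\<close>.\<close>

lemma gue_monomial_diff_unit:
  assumes "l \<in> {1..N}"
  shows "gue_monomial n z N (\<lambda>i. K i - unit_mi l i) x
       = gue_stat n z l x ^ (K l - 1) * (\<Prod>j\<in>{1..N} - {l}. gue_stat n z j x ^ K j)"
proof -
  have "(\<Prod>j\<in>{1..N} - {l}. gue_stat n z j x ^ (K j - unit_mi l j)) = (\<Prod>j\<in>{1..N} - {l}. gue_stat n z j x ^ K j)"
    by (intro prod.cong) (auto simp: unit_mi_def)
  thus ?thesis
    unfolding gue_monomial_def by (subst prod.remove[OF _ assms]) (auto simp: unit_mi_def)
qed

context
  fixes n :: nat and z :: complex
  assumes n: "0 < n" and z: "Im z \<noteq> 0"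
begin

section \<open>Regularity and partial derivatives of the resolvent, its traces and the
  monomials\<close>

abbreviation (input) G where "G \<equiv> resolvent n z"
abbreviation (input) H where "H \<equiv> gue_dir n"

text \<open>Cramer's rule expresses the entries through determinants, hence through measurable entries.\<close>

lemma measurable_resolvent:
  assumes ij: "i < n" "j < n"
  shows "(\<lambda>x. G x $$ (i, j)) \<in> borel_measurable (gue_param_measure n)"
proof -
  let ?W = "gue_shifted n z"
  note R = resolvent_inverse[OF n z]
  have W: "(\<lambda>x. ?W x $$ (a, b)) \<in> borel_measurable (gue_param_measure n)" if "a < n" "b < n" for a b
    using measurable_gue_scaled[OF that] that by (simp add: gue_shifted_entry)
  have "G x $$ (i, j) = cofactor (?W x) j i / Determinant.det (?W x)" for x
  proof -
    have adj: "adj_mat (?W x) \<in> carrier_mat n n" by (rule adj_mat(1)[OF gue_shifted_carrier])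
    \<comment> \<open>Multiplying the equation for the inverse by the adjugate identifies the
      adjugate with the determinant times the resolvent.\<close>
    have "adj_mat (?W x) = adj_mat (?W x) * (?W x * G x)"
      unfolding R(2) using adj by simp
    also have "\<dots> = adj_mat (?W x) * ?W x * G x"
      using assoc_mult_mat[OF adj gue_shifted_carrier R(1)] by simp
    also have "\<dots> = Determinant.det (?W x) \<cdot>\<^sub>m G x"
      unfolding adj_mat(3)[OF gue_shifted_carrier]
      using mult_smult_assoc_mat[OF one_carrier_mat R(1)] left_mult_one_mat[OF R(1)] by simp
    finally have "adj_mat (?W x) $$ (i, j) = (Determinant.det (?W x) \<cdot>\<^sub>m G x) $$ (i, j)" by simp
    thus ?thesis using ij carrier_matD[OF R(1)[of x]] carrier_matD[OF gue_shifted_carrier[of n z x]] det_gue_shifted[OF n z]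
      by (simp add: adj_mat_def field_simps)
  qed
  moreover have "(\<lambda>x. cofactor (?W x) j i) \<in> borel_measurable (gue_param_measure n)"
    unfolding cofactor_def
  proof (intro borel_measurable_times borel_measurable_const measurable_det)
    show "mat_delete (?W x) j i \<in> carrier_mat (n - 1) (n - 1)" for x
      by (rule mat_delete_carrier[OF gue_shifted_carrier])
    fix a b assume "a < n - 1" "b < n - 1"
    moreover from this have "(if a < j then a else Suc a) < n" "(if b < i then b else Suc b) < n" by auto
    ultimately show "(\<lambda>x. mat_delete (?W x) j i $$ (a, b)) \<in> borel_measurable (gue_param_measure n)"
      using W by (simp add: mat_delete_def carrier_matD[OF gue_shifted_carrier])
  qed
  moreover have "(\<lambda>x. Determinant.det (?W x)) \<in> borel_measurable (gue_param_measure n)"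
    by (rule measurable_det[OF gue_shifted_carrier W])
  ultimately show ?thesis by simp
qed

text \<open>The entries are Lipschitz along the line: in \<open>resolvent_diff\<close> the matrix
  product is bounded independently of both parameters.\<close>

lemma resolvent_continuous_along:
  assumes ij: "i < n" "j < n"
  shows "continuous_on UNIV (\<lambda>t. G (x(p := t)) $$ (i, j))"
proof -
  define B where "B = 1 / \<bar>Im (spectral_point n z)\<bar>"
  have Gb: "cmod (G y $$ (a, b)) \<le> B" if "a < n" "b < n" for y a b
    unfolding B_def using resolvent_entry_bound[OF n z that] .
  have B0: "0 \<le> B" by (simp add: B_def)
  \<comment> \<open>\<open>C\<close> arises by expanding the triple product and bounding each
    resolvent entry by \<open>B\<close>.\<close>
  define C where "C = (\<Sum>a<n. B * (\<Sum>b<n. cmod (gue_dir n p $$ (a, b)) * B))"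
  have C: "cmod ((G y * (gue_dir n p * G y')) $$ (i, j)) \<le> C" for y y'
  proof -
    note R = resolvent_inverse(1)[OF n z]
    have "(G y * (gue_dir n p * G y')) $$ (i, j)
        = (\<Sum>a<n. G y $$ (i, a) * (\<Sum>b<n. gue_dir n p $$ (a, b) * G y' $$ (b, j)))"
      unfolding mat_mult_entry[OF R mult_carrier_mat[OF gue_dir_carrier R] ij]
      using mat_mult_entry[OF gue_dir_carrier R _ ij(2)] by (intro sum.cong) (auto simp del: index_mult_mat)
    thus ?thesis unfolding C_def using ij B0
      by (auto simp: norm_mult intro!: sum_norm_le order_trans[OF norm_sum] sum_mono mult_mono Gb sum_nonneg)
  qed
  show ?thesis
    unfolding continuous_on_eq_continuous_at[OF open_UNIV]
  proof
    fix s
    have "((\<lambda>t. G (x(p := t)) $$ (i, j) - G (x(p := s)) $$ (i, j)) \<longlongrightarrow> 0) (at s)"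
    proof (rule Lim_null_comparison)
      have "cmod (G (x(p := t)) $$ (i, j) - G (x(p := s)) $$ (i, j)) \<le> \<bar>t - s\<bar> * (1 / sqrt (real n) * C)" for t
        unfolding resolvent_diff[OF n z ij, of x p t s] norm_mult
        by (intro mult_mono C) (auto simp: norm_divide simp flip: of_real_diff)
      thus "\<forall>\<^sub>F t in at s. cmod (G (x(p := t)) $$ (i, j) - G (x(p := s)) $$ (i, j)) \<le> \<bar>t - s\<bar> * (1 / sqrt (real n) * C)"
        by simp
      have "((\<lambda>t. \<bar>t - s\<bar> * (1 / sqrt (real n) * C)) \<longlongrightarrow> \<bar>s - s\<bar> * (1 / sqrt (real n) * C)) (at s)"
        by (intro tendsto_intros)
      thus "((\<lambda>t. \<bar>t - s\<bar> * (1 / sqrt (real n) * C)) \<longlongrightarrow> 0) (at s)" by simp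
    qed
    thus "isCont (\<lambda>t. G (x(p := t)) $$ (i, j)) s"
      by (simp add: isCont_def LIM_zero_iff)
  qed
qed

lemma tame_resolvent: "tame_mat n G"
  unfolding tame_mat_def tame_def
  using resolvent_inverse(1)[OF n z] measurable_resolvent resolvent_entry_bound[OF n z]
    resolvent_continuous_along by blast

lemma has_partial_resolvent:
  assumes ij: "i < n" "j < n"
  shows "has_partial p (\<lambda>x. G x $$ (i, j)) (\<lambda>x. - (1 / complex_of_real (sqrt (real n))) * (G x * (gue_dir n p * G x)) $$ (i, j))"
  unfolding has_partial_def
proof (intro allI)
  fix x s
  \<comment> \<open>The difference quotient given by \<open>resolvent_diff\<close>. Only its left
    resolvent varies with \<open>t\<close>, so continuity of the entries suffices.\<close>
  let ?g = "\<lambda>t. - (1 / complex_of_real (sqrt (real n))) * (G (x(p := t)) * (gue_dir n p * G (x(p := s)))) $$ (i, j)"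
  note R = resolvent_inverse(1)[OF n z]
  have "isCont ?g s"
    unfolding mat_mult_entry[OF R mult_carrier_mat[OF gue_dir_carrier R] ij]
    using resolvent_continuous_along ij
    by (intro continuous_intros) (auto simp: continuous_on_eq_continuous_at)
  from has_vector_derivative_difference_quotient[of "\<lambda>t. G (x(p := t)) $$ (i, j)" s ?g, OF _ this]
  show "((\<lambda>t. G (x(p := t)) $$ (i, j)) has_vector_derivative ?g s) (at s)"
    using resolvent_diff[OF n z ij, of x p _ s] by (simp add: scaleR_conv_of_real)
qed

text \<open>All the powers of n that occur, apart from square roots that pair up, are integer powers
  of this number, which reduces the bookkeeping to field arithmetic.\<close>

definition cube_root :: complex where "cube_root = complex_of_real (real n powr (1/3))"

lemma cube_root_nz: "cube_root \<noteq> 0"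
  using n by (simp add: cube_root_def)

lemma cube_root_power: "cube_root ^ k = complex_of_real (real n powr (real k / 3))"
  using n by (simp add: cube_root_def powr_power flip: of_real_power)

lemma cube_root_inverse_power: "complex_of_real (real n powr (- (real k / 3))) = 1 / cube_root ^ k"
  unfolding cube_root_power by (simp add: powr_minus_divide)

lemma cube_root_cubed: "cube_root ^ 3 = of_nat n"
  unfolding cube_root_power using n by simp

lemma sqrt_n_squared: "complex_of_real (sqrt (real n)) * complex_of_real (sqrt (real n)) = of_nat n"
  by (simp flip: of_real_mult)

lemma spectral_point_cube_root: "spectral_point n z = 2 + z / cube_root ^ 2"
  using cube_root_inverse_power[of 2] by (simp add: spectral_point_def)

lemma gue_stat_eq:
  assumes "1 \<le> l"
  shows "gue_stat n z l x = 1 / cube_root ^ (2 * l) * ((if l = 1 then of_nat n else 0) + mtrace (G x ^\<^sub>m l))"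
  using cube_root_inverse_power[of "2 * l"] pow_mat_one[OF resolvent_inverse(1)[OF n z, of x]]
  by (auto simp: gue_stat_def gc_n1_def g_nk_def)

text \<open>Differentiating a factor G replaces it by a multiple of G H G. In the summand
  \<open>a\<close> that factor has \<open>a\<close> factors before it, giving \<open>a + 1\<close>
  resolvents to the left of \<open>H p\<close> and \<open>l - a\<close> to the right.\<close>

lemma has_partial_resolvent_pow:
  assumes ij: "i < n" "j < n"
  shows "has_partial p (\<lambda>x. (G x ^\<^sub>m l) $$ (i, j))
    (\<lambda>x. - (1 / complex_of_real (sqrt (real n))) * (\<Sum>a<l. (G x ^\<^sub>m (a + 1) * (H p * G x ^\<^sub>m (l - a))) $$ (i, j)))"
  using ij
proof (induction l arbitrary: i j)
  case 0
  have "(G x ^\<^sub>m 0) $$ (i, j) = (if i = j then 1 else 0)" for x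
    using 0 carrier_matD[OF resolvent_inverse(1)[OF n z, of x]] by simp
  thus ?case by (simp add: has_partial_const)
next
  case (Suc l)
  let ?c = "- (1 / complex_of_real (sqrt (real n)))"
  note R = resolvent_inverse(1)[OF n z]
  note RP = pow_carrier_mat[OF R]
  define D where "D = (\<lambda>x a. G x ^\<^sub>m (a + 1) * (H p * G x ^\<^sub>m (l - a)))"
  have DC: "D x a \<in> carrier_mat n n" for x a
    unfolding D_def by (intro mult_carrier_mat[of _ n n] RP gue_dir_carrier)
  have HG: "H p * G x \<in> carrier_mat n n" for x by (rule mult_carrier_mat[OF gue_dir_carrier R])
  have GHG: "G x * (H p * G x) \<in> carrier_mat n n" for x by (rule mult_carrier_mat[OF R HG])
  have "has_partial p (\<lambda>x. \<Sum>k<n. (G x ^\<^sub>m l) $$ (i, k) * G x $$ (k, j))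
     (\<lambda>x. \<Sum>k<n. (G x ^\<^sub>m l) $$ (i, k) * (?c * (G x * (H p * G x)) $$ (k, j))
              + (?c * (\<Sum>a<l. D x a $$ (i, k))) * G x $$ (k, j))"
    unfolding D_def using Suc
    by (intro has_partial_sum has_partial_mult has_partial_resolvent Suc.IH) auto
  moreover have "(\<Sum>k<n. (G x ^\<^sub>m l) $$ (i, k) * G x $$ (k, j)) = (G x ^\<^sub>m Suc l) $$ (i, j)" for x
    using mat_mult_entry[OF RP R Suc.prems, of x l x] by simp
  moreover have "(\<Sum>k<n. (G x ^\<^sub>m l) $$ (i, k) * (?c * (G x * (H p * G x)) $$ (k, j))
              + (?c * (\<Sum>a<l. D x a $$ (i, k))) * G x $$ (k, j))
      = ?c * (\<Sum>a<Suc l. (G x ^\<^sub>m (a + 1) * (H p * G x ^\<^sub>m (Suc l - a))) $$ (i, j))" for x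
  proof -
    have "(\<Sum>k<n. (G x ^\<^sub>m l) $$ (i, k) * (?c * (G x * (H p * G x)) $$ (k, j))
              + (?c * (\<Sum>a<l. D x a $$ (i, k))) * G x $$ (k, j))
      = ?c * ((\<Sum>k<n. (G x ^\<^sub>m l) $$ (i, k) * (G x * (H p * G x)) $$ (k, j))
              + (\<Sum>a<l. \<Sum>k<n. D x a $$ (i, k) * G x $$ (k, j)))"
      unfolding sum.swap[where A = "{..<l}" and B = "{..<n}"]
      by (simp only: sum.distrib distrib_left sum_distrib_left sum_distrib_right mult_ac)
    also have "\<dots> = ?c * ((G x ^\<^sub>m l * (G x * (H p * G x))) $$ (i, j) + (\<Sum>a<l. (D x a * G x) $$ (i, j)))"
      unfolding mat_mult_entry[OF RP GHG Suc.prems] mat_mult_entry[OF DC R Suc.prems] ..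
    \<comment> \<open>The derivative of the last factor becomes the new summand
      \<open>a = l\<close>; the earlier summands gain one resolvent on the right.\<close>
    also have "G x ^\<^sub>m l * (G x * (H p * G x)) = G x ^\<^sub>m (l + 1) * (H p * G x ^\<^sub>m (Suc l - l))"
      using assoc_mult_mat[OF RP R HG, of x l x x] pow_mat_one[OF R, of x] by simp
    also have "(\<Sum>a<l. (D x a * G x) $$ (i, j)) = (\<Sum>a<l. (G x ^\<^sub>m (a + 1) * (H p * G x ^\<^sub>m (Suc l - a))) $$ (i, j))"
    proof (intro sum.cong refl)
      fix a assume "a \<in> {..<l}"
      hence a: "Suc l - a = Suc (l - a)" by auto
      have "D x a * G x = G x ^\<^sub>m (a + 1) * (H p * G x ^\<^sub>m (l - a) * G x)"
        unfolding D_def by (rule assoc_mult_mat[OF RP mult_carrier_mat[OF gue_dir_carrier RP] R])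
      also have "H p * G x ^\<^sub>m (l - a) * G x = H p * G x ^\<^sub>m (Suc l - a)"
        unfolding a pow_mat.simps by (rule assoc_mult_mat[OF gue_dir_carrier RP R])
      finally show "(D x a * G x) $$ (i, j) = (G x ^\<^sub>m (a + 1) * (H p * G x ^\<^sub>m (Suc l - a))) $$ (i, j)"
        by simp
    qed
    finally show ?thesis by (simp only: sum.lessThan_Suc add.commute)
  qed
  ultimately show ?case by simp
qed

text \<open>Cyclicity of the trace makes all \<open>l\<close> summands of the previous derivative
  equal.\<close>

lemma has_partial_mtrace_pow:
  "has_partial p (\<lambda>x. mtrace (G x ^\<^sub>m l))
    (\<lambda>x. - (1 / complex_of_real (sqrt (real n))) * (of_nat l * mtrace (H p * G x ^\<^sub>m (l + 1))))"
proof -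
  let ?c = "- (1 / complex_of_real (sqrt (real n)))"
  note R = resolvent_inverse(1)[OF n z]
  note RP = pow_carrier_mat[OF R]
  have "has_partial p (\<lambda>x. \<Sum>i<n. (G x ^\<^sub>m l) $$ (i, i))
      (\<lambda>x. \<Sum>i<n. ?c * (\<Sum>a<l. (G x ^\<^sub>m (a + 1) * (H p * G x ^\<^sub>m (l - a))) $$ (i, i)))"
    by (intro has_partial_sum has_partial_resolvent_pow) auto
  moreover have "(\<Sum>i<n. ?c * (\<Sum>a<l. (G x ^\<^sub>m (a + 1) * (H p * G x ^\<^sub>m (l - a))) $$ (i, i)))
      = ?c * (of_nat l * mtrace (H p * G x ^\<^sub>m (l + 1)))" for x
  proof -
    have tr: "mtrace (G x ^\<^sub>m (a + 1) * (H p * G x ^\<^sub>m (l - a))) = mtrace (H p * G x ^\<^sub>m (l + 1))" if "a < l" for a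
    proof -
      have "H p * G x ^\<^sub>m (l - a) * G x ^\<^sub>m (a + 1) = H p * (G x ^\<^sub>m (l - a) * G x ^\<^sub>m (a + 1))"
        by (rule assoc_mult_mat[OF gue_dir_carrier RP RP])
      also have "G x ^\<^sub>m (l - a) * G x ^\<^sub>m (a + 1) = G x ^\<^sub>m (l + 1)"
        using that by (simp add: pow_mat_add[OF R, symmetric] del: pow_mat.simps)
      finally show ?thesis
        using mtrace_comm[OF RP mult_carrier_mat[OF gue_dir_carrier RP]] by metis
    qed
    have C: "G x ^\<^sub>m (a + 1) * (H p * G x ^\<^sub>m (l - a)) \<in> carrier_mat n n" for a
      by (rule mult_carrier_mat[OF RP mult_carrier_mat[OF gue_dir_carrier RP]])
    have "(\<Sum>i<n. ?c * (\<Sum>a<l. (G x ^\<^sub>m (a + 1) * (H p * G x ^\<^sub>m (l - a))) $$ (i, i)))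
        = ?c * (\<Sum>a<l. mtrace (G x ^\<^sub>m (a + 1) * (H p * G x ^\<^sub>m (l - a))))"
      unfolding mtrace_carrier[OF C] sum_distrib_left[symmetric]
      by (subst sum.swap) (rule refl)
    also have "\<dots> = ?c * (\<Sum>a<l. mtrace (H p * G x ^\<^sub>m (l + 1)))"
      using tr by (intro arg_cong2[where f = "(*)"] sum.cong refl) auto
    finally show ?thesis by simp
  qed
  ultimately show ?thesis by (simp only: mtrace_carrier[OF RP])
qed

lemma has_partial_mtrace_dir:
  "has_partial p (\<lambda>x. mtrace (H p * G x))
    (\<lambda>x. - (1 / complex_of_real (sqrt (real n))) * mtrace (H p * (G x * (H p * G x))))"
proof -
  let ?c = "- (1 / complex_of_real (sqrt (real n)))"
  note R = resolvent_inverse(1)[OF n z]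
  have C: "G x * (H p * G x) \<in> carrier_mat n n" for x
    by (rule mult_carrier_mat[OF R mult_carrier_mat[OF gue_dir_carrier R]])
  have "has_partial p (\<lambda>x. \<Sum>i<n. \<Sum>k<n. H p $$ (i, k) * G x $$ (k, i))
      (\<lambda>x. \<Sum>i<n. \<Sum>k<n. H p $$ (i, k) * (?c * (G x * (H p * G x)) $$ (k, i)))"
    by (intro has_partial_sum has_partial_cmult has_partial_resolvent) auto
  moreover have "(\<Sum>i<n. \<Sum>k<n. H p $$ (i, k) * (?c * (G x * (H p * G x)) $$ (k, i)))
      = ?c * mtrace (H p * (G x * (H p * G x)))" for x
    unfolding mtrace_mult[OF gue_dir_carrier C] sum_distrib_left by (simp only: mult_ac)
  ultimately show ?thesis by (simp only: mtrace_mult[OF gue_dir_carrier R])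
qed

lemma has_partial_gue_stat:
  assumes "1 \<le> l"
  shows "has_partial p (gue_stat n z l)
    (\<lambda>x. 1 / cube_root ^ (2 * l) * (- (1 / complex_of_real (sqrt (real n))) * (of_nat l * mtrace (H p * G x ^\<^sub>m (l + 1)))))"
  using has_partial_cmult[OF has_partial_add[OF has_partial_const has_partial_mtrace_pow], of p]
  by (simp only: gue_stat_eq[OF assms, abs_def] add_0)

lemma tame_gue_stat:
  assumes "1 \<le> l"
  shows "tame n (gue_stat n z l)"
  unfolding gue_stat_eq[OF assms, abs_def] by (intro tame_intros tame_mtrace tame_mat_pow tame_resolvent)

lemma tame_gue_monomial: "tame n (gue_monomial n z N K)"
  unfolding gue_monomial_def[abs_def] by (intro tame_intros tame_gue_stat) auto

lemma has_partial_gue_monomial: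
  "has_partial p (gue_monomial n z N K)
    (\<lambda>x. - (1 / complex_of_real (sqrt (real n))) *
      (\<Sum>l\<in>{1..N}. of_nat (l * K l) / cube_root ^ (2 * l) * mtrace (H p * G x ^\<^sub>m (l + 1))
         * gue_monomial n z N (\<lambda>i. K i - unit_mi l i) x))"
proof -
  let ?c = "- (1 / complex_of_real (sqrt (real n)))"
  let ?d = "\<lambda>l x. 1 / cube_root ^ (2 * l) * (?c * (of_nat l * mtrace (H p * G x ^\<^sub>m (l + 1))))"
  have "has_partial p (\<lambda>x. \<Prod>l\<in>{1..N}. gue_stat n z l x ^ K l)
      (\<lambda>x. \<Sum>l\<in>{1..N}. of_nat (K l) * gue_stat n z l x ^ (K l - 1) * ?d l x
          * (\<Prod>j\<in>{1..N} - {l}. gue_stat n z j x ^ K j))"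
    by (intro has_partial_prod has_partial_power has_partial_gue_stat) auto
  moreover have "(\<Sum>l\<in>{1..N}. of_nat (K l) * gue_stat n z l x ^ (K l - 1) * ?d l x
          * (\<Prod>j\<in>{1..N} - {l}. gue_stat n z j x ^ K j))
     = ?c * (\<Sum>l\<in>{1..N}. of_nat (l * K l) / cube_root ^ (2 * l) * mtrace (H p * G x ^\<^sub>m (l + 1))
         * gue_monomial n z N (\<lambda>i. K i - unit_mi l i) x)" for x
    unfolding sum_distrib_left
    by (intro sum.cong refl) (simp add: gue_monomial_diff_unit mult_ac)
  ultimately show ?thesis by (simp only: gue_monomial_def[abs_def])
qed

text \<open>Take the trace of A G = 1 + w G and expand A in the coordinates. The explicit factor
  \<open>x p\<close> is what integration by parts removes.\<close>

lemma trace_expansion: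
  "of_nat n + spectral_point n z * mtrace (G x)
     = 1 / complex_of_real (sqrt (real n)) * (\<Sum>p\<in>{..<n}\<times>{..<n}. complex_of_real (x p) * mtrace (H p * G x))"
proof -
  let ?P = "{..<n}\<times>{..<n}" and ?q = "complex_of_real (sqrt (real n))"
  note R = resolvent_inverse(1)[OF n z]
  have "mtrace (gue_shifted n z x * G x) = of_nat n"
    unfolding resolvent_inverse(2)[OF n z] by (simp add: mtrace_def)
  moreover have "mtrace (gue_shifted n z x * G x)
      = (\<Sum>a<n. \<Sum>b<n. gue_scaled n x a b * G x $$ (b, a)) - spectral_point n z * mtrace (G x)"
    unfolding mtrace_mult[OF gue_shifted_carrier R] mtrace_carrier[OF R] sum_distrib_left sum_subtractf[symmetric]
    by (intro sum.cong refl) (simp add: gue_shifted_apply)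
  ultimately have "of_nat n + spectral_point n z * mtrace (G x) = (\<Sum>a<n. \<Sum>b<n. gue_scaled n x a b * G x $$ (b, a))"
    by (simp add: algebra_simps)
  also have "\<dots> = (\<Sum>a<n. \<Sum>b<n. \<Sum>p\<in>?P. 1 / ?q * (complex_of_real (x p) * (H p $$ (a, b) * G x $$ (b, a))))"
    by (intro sum.cong refl)
      (simp add: gue_scaled_def gue_entry_decomp[of _ n] gue_dir_def sum_distrib_left sum_distrib_right sum_divide_distrib mult_ac)
  also have "\<dots> = (\<Sum>p\<in>?P. \<Sum>a<n. \<Sum>b<n. 1 / ?q * (complex_of_real (x p) * (H p $$ (a, b) * G x $$ (b, a))))"
    unfolding sum.swap[where A = ?P and B = "{..<n}"] ..
  also have "\<dots> = 1 / ?q * (\<Sum>p\<in>?P. complex_of_real (x p) * mtrace (H p * G x))"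
    unfolding mtrace_mult[OF gue_dir_carrier R] sum_distrib_left ..
  finally show ?thesis .
qed

subsection \<open>The Schwinger-Dyson equation and the recursion\<close>

lemma schwinger_dyson:
  "(\<integral>x. (of_nat n + spectral_point n z * mtrace (G x)) * gue_monomial n z N K x \<partial>gue_param_measure n)
   = - (1 / of_nat n) * (\<integral>x. mtrace (G x) * mtrace (G x) * gue_monomial n z N K x
        + (\<Sum>l\<in>{1..N}. of_nat (l * K l) / cube_root ^ (2 * l) * mtrace (G x ^\<^sub>m (l + 2))
             * gue_monomial n z N (\<lambda>i. K i - unit_mi l i) x) \<partial>gue_param_measure n)"
proof -
  let ?M = "gue_param_measure n" and ?P = "{..<n}\<times>{..<n}"
  let ?q = "complex_of_real (sqrt (real n))"
  let ?F = "gue_monomial n z N K" and ?Q = "\<lambda>l. gue_monomial n z N (\<lambda>i. K i - unit_mi l i)"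
  let ?s = "\<lambda>p. complex_of_real ((gue_sd p)\<^sup>2)"
  let ?k = "\<lambda>l. of_nat (l * K l) / cube_root ^ (2 * l)"
  note R = resolvent_inverse(1)[OF n z]
  note RP = pow_carrier_mat[OF R]
  \<comment> \<open>The derivative in coordinate \<open>p\<close> of
    \<open>mtrace (H p * G x)\<close> times the monomial, by the product rule.\<close>
  define D where "D p x = mtrace (H p * G x) *
      (- (1 / ?q) * (\<Sum>l\<in>{1..N}. ?k l * mtrace (H p * G x ^\<^sub>m (l + 1)) * ?Q l x))
      + - (1 / ?q) * mtrace (H p * (G x * (H p * G x))) * ?F x" for p x
  note tame_rules = tame_intros tame_mtrace tame_mat_mult tame_mat_pow tame_mat_const
    gue_dir_carrier tame_resolvent tame_gue_monomial
  have tame_D: "tame n (D p)" for p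
    unfolding D_def[abs_def] by (intro tame_rules)
  have tame_HF: "tame n (\<lambda>x. mtrace (H p * G x) * ?F x)" for p
    by (intro tame_rules)
  have ibp: "(\<integral>x. complex_of_real (x p) * (mtrace (H p * G x) * ?F x) \<partial>?M) = ?s p * (\<integral>x. D p x \<partial>?M)"
    if "p \<in> ?P" for p
    by (rule gue_ibp[OF that tame_HF tame_D])
      (unfold D_def[abs_def], intro has_partial_mult has_partial_mtrace_dir has_partial_gue_monomial)
  have "(\<integral>x. (of_nat n + spectral_point n z * mtrace (G x)) * ?F x \<partial>?M)
      = (\<integral>x. 1 / ?q * (\<Sum>p\<in>?P. complex_of_real (x p) * (mtrace (H p * G x) * ?F x)) \<partial>?M)"
    unfolding trace_expansion by (simp only: sum_distrib_right mult.assoc)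
  also have "\<dots> = 1 / ?q * (\<Sum>p\<in>?P. \<integral>x. complex_of_real (x p) * (mtrace (H p * G x) * ?F x) \<partial>?M)"
    unfolding integral_mult_right_zero
    by (subst Bochner_Integration.integral_sum[OF coord_mult_integrable[OF _ tame_HF]]) auto
  also have "\<dots> = 1 / ?q * (\<Sum>p\<in>?P. \<integral>x. ?s p * D p x \<partial>?M)"
    using ibp by (simp only: integral_mult_right_zero cong: sum.cong)
  \<comment> \<open>The sum returns under the integral so that the contractions can be carried out
    pointwise in \<open>x\<close>.\<close>
  also have "\<dots> = 1 / ?q * (\<integral>x. (\<Sum>p\<in>?P. ?s p * D p x) \<partial>?M)"
    by (subst Bochner_Integration.integral_sum[OF tame_integrable[OF tame_mult[OF tame_const tame_D]]]) (rule refl)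
  also have "(\<lambda>x. \<Sum>p\<in>?P. ?s p * D p x) = (\<lambda>x. - (1 / ?q) * (mtrace (G x) * mtrace (G x) * ?F x
        + (\<Sum>l\<in>{1..N}. ?k l * mtrace (G x ^\<^sub>m (l + 2)) * ?Q l x)))"
  proof
    fix x
    have "?s p * D p x = - (1 / ?q) * (?s p * mtrace (H p * (G x * (H p * G x))) * ?F x
        + (\<Sum>l\<in>{1..N}. ?k l * (?s p * (mtrace (H p * G x) * mtrace (H p * G x ^\<^sub>m (l + 1)))) * ?Q l x))" for p
      unfolding D_def distrib_left sum_distrib_left
      by (simp only: mult_ac add.commute)
    hence "(\<Sum>p\<in>?P. ?s p * D p x) = - (1 / ?q) * (\<Sum>p\<in>?P. ?s p * mtrace (H p * (G x * (H p * G x))) * ?F x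
        + (\<Sum>l\<in>{1..N}. ?k l * (?s p * (mtrace (H p * G x) * mtrace (H p * G x ^\<^sub>m (l + 1)))) * ?Q l x))"
      by (simp only: sum_distrib_left[of "- (1 / ?q)" _ ?P])
    also have "\<dots> = - (1 / ?q) * ((\<Sum>p\<in>?P. ?s p * mtrace (H p * (G x * (H p * G x)))) * ?F x
        + (\<Sum>l\<in>{1..N}. ?k l * (\<Sum>p\<in>?P. ?s p * (mtrace (H p * G x) * mtrace (H p * G x ^\<^sub>m (l + 1)))) * ?Q l x))"
      by (simp only: sum.distrib sum_distrib_right sum_distrib_left sum.swap[where A = "{1..N}" and B = ?P])
    \<comment> \<open>The derivative that fell on the trace gives the product of two traces; the one
      that fell on the monomial gives the single traces of order \<open>l + 2\<close>.\<close>
    also have "(\<Sum>p\<in>?P. ?s p * mtrace (H p * (G x * (H p * G x)))) = mtrace (G x) * mtrace (G x)"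
      by (rule gue_contract_one[OF R R])
    also have "(\<lambda>l. \<Sum>p\<in>?P. ?s p * (mtrace (H p * G x) * mtrace (H p * G x ^\<^sub>m (l + 1))))
        = (\<lambda>l. mtrace (G x ^\<^sub>m (l + 2)))"
    proof
      fix l
      have "G x * G x ^\<^sub>m (l + 1) = G x ^\<^sub>m (1 + (l + 1))"
        unfolding pow_mat_add[OF R, of x 1 "l + 1"] using pow_mat_one[OF R, of x] by simp
      thus "(\<Sum>p\<in>?P. ?s p * (mtrace (H p * G x) * mtrace (H p * G x ^\<^sub>m (l + 1)))) = mtrace (G x ^\<^sub>m (l + 2))"
        unfolding gue_contract_two[OF R RP] by (simp add: numeral_2_eq_2)
    qed
    finally show "(\<Sum>p\<in>?P. ?s p * D p x) = - (1 / ?q) * (mtrace (G x) * mtrace (G x) * ?F x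
        + (\<Sum>l\<in>{1..N}. ?k l * mtrace (G x ^\<^sub>m (l + 2)) * ?Q l x))" .
  qed
  finally show ?thesis
    unfolding integral_mult_right_zero by (simp add: sqrt_n_squared flip: mult.assoc)
qed

lemma moment_recursion:
  assumes K: "multi_index K"
  shows "moment n z K * z - moment n z (\<lambda>i. K i + 2 * unit_mi 1 i)
      - (\<Sum>l\<in>{l. 1 \<le> l \<and> K l \<noteq> 0}.
           of_nat (l * K l) * moment n z (\<lambda>i. K i - unit_mi l i + unit_mi (l + 2) i))
    = z * complex_of_real (real n powr (-1/3)) * moment n z (\<lambda>i. K i + unit_mi 1 i)"
proof -
  let ?M = "gue_param_measure n" and ?r = cube_root
  obtain N0 where N0: "\<And>l. K l \<noteq> 0 \<Longrightarrow> l \<le> N0"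
    using K unfolding multi_index_def finite_nat_set_iff_bounded_le by auto
  \<comment> \<open>The two extra places make room for the raised index
    \<open>l + 2\<close>.\<close>
  define N where "N = N0 + 2"
  let ?F = "gue_monomial n z N K" and ?Q = "\<lambda>l. gue_monomial n z N (\<lambda>i. K i - unit_mi l i)"
  let ?g = "gue_stat n z"
  let ?S = "{l. 1 \<le> l \<and> K l \<noteq> 0}"
  have S: "?S \<subseteq> {1..N}" "finite ?S" "\<And>l. l \<in> ?S \<Longrightarrow> l + 2 \<le> N"
  proof -
    show "?S \<subseteq> {1..N}" using N0 by (fastforce simp: N_def)
    thus "finite ?S" by (rule finite_subset) simp
    show "\<And>l. l \<in> ?S \<Longrightarrow> l + 2 \<le> N" using N0 by (auto simp: N_def)
  qed
  have supp: "K l = 0" if "N < l" for l using N0[of l] that by (force simp: N_def)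
  have N1: "1 \<le> N" by (simp add: N_def)
  have r: "?r \<noteq> 0" by (rule cube_root_nz)
  have n_r: "of_nat n = ?r ^ 3" using cube_root_cubed by simp
  note tame_rules = tame_intros tame_gue_monomial tame_gue_stat
  have mK: "moment n z K = (\<integral>x. ?F x \<partial>?M)"
    by (rule moment_eq_monomial[OF N1 supp])
  have mK1: "moment n z (\<lambda>i. K i + unit_mi 1 i) = (\<integral>x. ?g 1 x * ?F x \<partial>?M)"
    using moment_add_unit[OF N1 supp, where l = 1 and m = 1] N1 by simp
  have mK2: "moment n z (\<lambda>i. K i + 2 * unit_mi 1 i) = (\<integral>x. ?g 1 x ^ 2 * ?F x \<partial>?M)"
    using moment_add_unit[OF N1 supp, where l = 1 and m = 2] N1 by simp
  have mKl: "moment n z (\<lambda>i. K i - unit_mi l i + unit_mi (l + 2) i) = (\<integral>x. ?g (l + 2) x * ?Q l x \<partial>?M)"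
    if "l \<in> ?S" for l
    using moment_add_unit[OF N1, where K = "\<lambda>i. K i - unit_mi l i" and l = "l + 2" and m = 1] S(3)[OF that] supp by simp
  define \<Sigma> where "\<Sigma> x = (\<Sum>l\<in>?S. of_nat (l * K l) * (?g (l + 2) x * ?Q l x))" for x
  have tame_\<Sigma>: "tame n \<Sigma>" unfolding \<Sigma>_def[abs_def] by (intro tame_rules) auto
  have int_\<Sigma>: "(\<integral>x. \<Sigma> x \<partial>?M)
      = (\<Sum>l\<in>?S. of_nat (l * K l) * moment n z (\<lambda>i. K i - unit_mi l i + unit_mi (l + 2) i))"
  proof -
    have "(\<integral>x. \<Sigma> x \<partial>?M) = (\<Sum>l\<in>?S. \<integral>x. of_nat (l * K l) * (?g (l + 2) x * ?Q l x) \<partial>?M)"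
      unfolding \<Sigma>_def by (intro Bochner_Integration.integral_sum tame_integrable tame_rules) auto
    thus ?thesis using mKl by (simp only: integral_mult_right_zero cong: sum.cong)
  qed
  have T: "mtrace (G x) = ?r ^ 2 * ?g 1 x - ?r ^ 3" for x
    using gue_stat_eq[of 1 x] pow_mat_one[OF resolvent_inverse(1)[OF n z, of x]] r
    by (simp add: n_r field_simps power2_eq_square)
  \<comment> \<open>The statistic of index \<open>l + 2\<close> carries the scale
    \<open>?r ^ (2 * l + 4)\<close> in its denominator; the surplus over \<open>?r ^ (2 * l)\<close>
    is the factor \<open>?r ^ 4\<close>.\<close>
  have sum_eq: "(\<Sum>l\<in>{1..N}. of_nat (l * K l) / ?r ^ (2 * l) * mtrace (G x ^\<^sub>m (l + 2)) * ?Q l x) = ?r ^ 4 * \<Sigma> x" for x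
  proof -
    have "?r ^ 4 * \<Sigma> x = (\<Sum>l\<in>?S. of_nat (l * K l) / ?r ^ (2 * l) * mtrace (G x ^\<^sub>m (l + 2)) * ?Q l x)"
      unfolding \<Sigma>_def sum_distrib_left using r
      by (intro sum.cong refl) (simp add: gue_stat_eq power_add power4_eq_xxxx field_simps del: pow_mat.simps)
    also have "\<dots> = (\<Sum>l\<in>{1..N}. of_nat (l * K l) / ?r ^ (2 * l) * mtrace (G x ^\<^sub>m (l + 2)) * ?Q l x)"
      using S(1) by (intro sum.mono_neutral_left) auto
    finally show ?thesis by simp
  qed
  have lhs: "(of_nat n + spectral_point n z * mtrace (G x)) * ?F x
      = (2 * ?r ^ 2 + z) * (?g 1 x * ?F x) - (?r ^ 3 + z * ?r) * ?F x" for x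
    unfolding T spectral_point_cube_root n_r using r by (simp add: field_simps power2_eq_square power3_eq_cube)
  have rhs: "mtrace (G x) * mtrace (G x) * ?F x + ?r ^ 4 * \<Sigma> x
      = ?r ^ 4 * (?g 1 x ^ 2 * ?F x) - 2 * ?r ^ 5 * (?g 1 x * ?F x) + ?r ^ 6 * ?F x + ?r ^ 4 * \<Sigma> x" for x
    unfolding T by (simp add: algebra_simps power2_eq_square eval_nat_numeral)
  have I: "integrable ?M ?F" "integrable ?M (\<lambda>x. ?g 1 x * ?F x)" "integrable ?M (\<lambda>x. ?g 1 x ^ 2 * ?F x)" "integrable ?M \<Sigma>"
    by (intro tame_integrable tame_rules tame_\<Sigma>; simp)+
  define m0 m1 m2 s where "m0 = (\<integral>x. ?F x \<partial>?M)" and "m1 = (\<integral>x. ?g 1 x * ?F x \<partial>?M)"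
    and "m2 = (\<integral>x. ?g 1 x ^ 2 * ?F x \<partial>?M)" and "s = (\<integral>x. \<Sigma> x \<partial>?M)"
  have "(2 * ?r ^ 2 + z) * m1 - (?r ^ 3 + z * ?r) * m0
      = - (1 / ?r ^ 3) * (?r ^ 4 * m2 - 2 * ?r ^ 5 * m1 + ?r ^ 6 * m0 + ?r ^ 4 * s)"
    using schwinger_dyson[of N K] I
    unfolding n_r lhs[unfolded n_r] sum_eq rhs m0_def m1_def m2_def s_def by simp
  also have "\<dots> = - ?r * m2 + 2 * ?r ^ 2 * m1 - ?r ^ 3 * m0 - ?r * s"
    using r by (simp add: field_simps eval_nat_numeral)
  \<comment> \<open>The terms \<open>2 * ?r ^ 2 * m1\<close> and \<open>- ?r ^ 3 * m0\<close> stand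
    on both sides and cancel, which is the effect of centring at the edge 2.\<close>
  finally have "?r * (m0 * z - m2 - s) = z * m1" by (simp add: algebra_simps)
  hence "m0 * z - m2 - s = z * (1 / ?r) * m1" using r by (simp add: field_simps)
  moreover have "1 / ?r = complex_of_real (real n powr (-1/3))"
    using cube_root_inverse_power[of 1] by simp
  ultimately show ?thesis
    unfolding mK mK1 mK2 int_\<Sigma>[symmetric] m0_def m1_def m2_def s_def by simp
qed

end

lemma moment_zero: "moment n z (\<lambda>_. 0) = 1"
  using prob_space.prob_space[OF prob_space_gue] by (simp add: moment_def)

theorem theorem1p2:
  fixes z :: complex
  assumes "Im z \<noteq> 0"
  shows "(\<forall>K. multi_index K \<and> (\<exists>l. K l \<noteq> 0) \<longrightarrow>
           (\<exists>(e1 :: nat \<Rightarrow> complex) (e2 :: nat \<Rightarrow> complex)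
              (e3 :: nat \<Rightarrow> nat \<Rightarrow> complex) (d :: nat \<Rightarrow> complex).
              e1 \<in> O(\<lambda>n. complex_of_real (real n powr (-2/3))) \<and>
              e2 \<in> O(\<lambda>n. complex_of_real (real n powr (-2/3))) \<and>
              (\<forall>l. e3 l \<in> O(\<lambda>n. complex_of_real (real n powr (-2/3)))) \<and>
              d \<in> O(\<lambda>n. complex_of_real (real n powr (-1/3))) \<and>
              (\<forall>\<^sub>F n in at_top.
                 moment n z K * (z + e1 n)
                 - moment n z (\<lambda>i. K i + 2 * unit_mi 1 i) * (1 + e2 n)
                 - (\<Sum>l\<in>{l. 1 \<le> l \<and> K l \<noteq> 0}.
                      of_nat (l * K l)
                      * moment n z (\<lambda>i. K i - unit_mi l i + unit_mi (l + 2) i)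
                      * (1 + e3 l n))
                 = d n * moment n z (\<lambda>i. K i + unit_mi 1 i))))
       \<and> (\<exists>(e1 :: nat \<Rightarrow> complex) (e2 :: nat \<Rightarrow> complex) (d :: nat \<Rightarrow> complex).
              e1 \<in> O(\<lambda>n. complex_of_real (real n powr (-2/3))) \<and>
              e2 \<in> O(\<lambda>n. complex_of_real (real n powr (-2/3))) \<and>
              d \<in> O(\<lambda>n. complex_of_real (real n powr (-1/3))) \<and>
              (\<forall>\<^sub>F n in at_top.
                 z + e1 n - moment n z (\<lambda>i. 2 * unit_mi 1 i) * (1 + e2 n)
                 = d n * moment n z (unit_mi 1)))"
proof (intro conjI allI impI)
  \<comment> \<open>The recursion being exact, every other error function is taken to be 0, and
    "eventually" only means \<open>n > 0\<close>.\<close>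
  let ?d = "\<lambda>n. z * complex_of_real (real n powr (-1/3))"
  have zero: "(\<lambda>_. 0 :: complex) \<in> O(\<lambda>n. complex_of_real (real n powr (-2/3)))" by simp
  have d: "?d \<in> O(\<lambda>n. complex_of_real (real n powr (-1/3)))" by simp
  {
    fix K assume K: "multi_index K \<and> (\<exists>l. K l \<noteq> 0)"
    show "\<exists>(e1 :: nat \<Rightarrow> complex) e2 (e3 :: nat \<Rightarrow> nat \<Rightarrow> complex) d.
        e1 \<in> O(\<lambda>n. complex_of_real (real n powr (-2/3))) \<and>
        e2 \<in> O(\<lambda>n. complex_of_real (real n powr (-2/3))) \<and>
        (\<forall>l. e3 l \<in> O(\<lambda>n. complex_of_real (real n powr (-2/3)))) \<and>
        d \<in> O(\<lambda>n. complex_of_real (real n powr (-1/3))) \<and>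
        (\<forall>\<^sub>F n in at_top.
           moment n z K * (z + e1 n)
           - moment n z (\<lambda>i. K i + 2 * unit_mi 1 i) * (1 + e2 n)
           - (\<Sum>l\<in>{l. 1 \<le> l \<and> K l \<noteq> 0}.
                of_nat (l * K l)
                * moment n z (\<lambda>i. K i - unit_mi l i + unit_mi (l + 2) i)
                * (1 + e3 l n))
           = d n * moment n z (\<lambda>i. K i + unit_mi 1 i))"
      using K zero d moment_recursion[OF _ assms, of _ K]
      by (intro exI[of _ "\<lambda>_. 0"] exI[of _ "\<lambda>_ _. 0"] exI[of _ ?d] conjI allI)
        (auto intro!: eventually_mono[OF eventually_gt_at_top[of 0]])
  }
  \<comment> \<open>At the zero multi-index the sum over \<open>l\<close> is empty and the leading
    moment is 1.\<close>
  have K0: "multi_index (\<lambda>_. 0)" by (simp add: multi_index_def)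
  show "\<exists>(e1 :: nat \<Rightarrow> complex) e2 d.
      e1 \<in> O(\<lambda>n. complex_of_real (real n powr (-2/3))) \<and>
      e2 \<in> O(\<lambda>n. complex_of_real (real n powr (-2/3))) \<and>
      d \<in> O(\<lambda>n. complex_of_real (real n powr (-1/3))) \<and>
      (\<forall>\<^sub>F n in at_top.
         z + e1 n - moment n z (\<lambda>i. 2 * unit_mi 1 i) * (1 + e2 n) = d n * moment n z (unit_mi 1))"
    using zero d moment_recursion[OF _ assms K0]
    by (intro exI[of _ "\<lambda>_. 0"] exI[of _ ?d] conjI)
      (auto simp: moment_zero intro!: eventually_mono[OF eventually_gt_at_top[of 0]])
qed

end
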